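(* Let $\mathscr{S}$ be an open subset of $\mathrm{Im}\mathbb{HP}^n$. The following two data are equivalent: (Ia) a symmetric matrix $(\mathscr{U}_{IJ})_{I,J=0,\dots,n}$ of sections of $E^{(-1,\mathbf 1)}$ over $\mathscr{S}$ satisfying the first-order differential constraints $\vec\nabla_I\mathscr{U}_{KJ}=\vec\nabla_J\mathscr{U}_{KI}$ for all $I,J,K$; (Ib) a section $\mathscr{U}$ of the line bundle $E^{(+1,\mathbf 1)}$ over $\mathscr{S}$ satisfying the second-order differential constraints $\vec\nabla_I\times\vec\nabla_J\,\mathscr{U}=\vec0$ for all $I,J$. The maps between them (from (Ia) to (Ib) and from (Ib) to (Ia)) are given, respectively, by $$\mathscr{U}=2\,\mathscr{U}_{IJ}\,\vec\rho^{\,I}\cdot\vec\rho^{\,J}\qquad\text{and}\qquad\mathscr{U}_{IJ}=\tfrac14\,\vec\nabla_I\cdot\vec\nabla_J\,\mathscr{U}.$$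
   Context: Indices $I,J,K$ run over $0,\dots,n$; repeated indices are summed. Imaginary quaternions are identified with $\mathbb{R}^3$. **The space $\mathrm{Im}\mathbb{HP}^n$.** Points of $\mathbb{R}^{n+1}\otimes\mathbb{R}^3$ are configurations $(\vec x^{\,I})_{I=0,\dots,n}$ of $n+1$ vectors in $\mathbb{R}^3$. The group $\mathbb{H}^\times/\mathbb{Z}_2\cong\mathbb{R}^+\times SO(3)$ acts by $\vec x^{\,I}\mapsto\bar q\,\vec x^{\,I}q$ (rigid rotations and simultaneous scalings by $|q|^2$), with infinitesimal generators $\vec L=-\vec x^{\,K}\times\vec\partial_K$ and $L_0=\vec x^{\,K}\cdot\vec\partial_K$, where $\vec\partial_K=\partial/\partial\vec x^{\,K}$. A configuration is degenerate if its stabilizer is non-trivial, i.e. all its vectors are collinear (span a space of dimension $\le1$); $C_{\rm deg}$ is the set of degenerate configurations. $\mathrm{Im}\mathbb{HP}^n=(\mathbb{R}^{n+1}\otimes\mathbb{R}^3\smallsetminus C_{\rm deg})/(\mathbb{H}^\times/\mathbb{Z}_2)$. **Inhomogeneous coordinates.** Locally one chooses a smooth slice transversal to the orbits, meeting each orbit at most once; its points $(\vec\rho^{\,I})$ serve as local (inhomogeneous) coordinates on $\mathrm{Im}\mathbb{HP}^n$, and any configuration over the chart is uniquely $\vec x^{\,I}=\bar q\,\vec\rho^{\,I}q$ with $q\in\mathbb{H}^\times/\mathbb{Z}_2$. **Bundles and connections.** $E^{(w,\mathbf 1)}$ is the line bundle over $\mathrm{Im}\mathbb{HP}^n$ associated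 to the principal $\mathbb{H}^\times/\mathbb{Z}_2$-bundle $\mathbb{R}^{n+1}\otimes\mathbb{R}^3\smallsetminus C_{\rm deg}$ with scaling weight $w$ and trivial $SO(3)$ representation: a section $\mathscr{F}$ over $\mathscr{S}$ corresponds to a function $F$ on the preimage of $\mathscr{S}$ with $\vec LF=\vec0$, $L_0F=wF$, via $F=|q|^{2w}\mathscr{F}$, so that in the chart $\mathscr{F}$ is the restriction of $F$ to the slice. The flat connection on $\mathbb{R}^{n+1}\otimes\mathbb{R}^3$ induces operators $\vec\nabla_I$ by $\partial F/\partial x^I_i=|q|^{2w-2}R_{ij}(q^{-1})\nabla_{Ij}\mathscr{F}$, where $q^{-1}u_iq=R_{ij}(q)u_j$ for the standard imaginary quaternions $u_1,u_2,u_3$; equivalently $\nabla_{Ii}\mathscr{F}$ is the restriction of $\partial F/\partial x^I_i$ to the slice, and likewise $\nabla_{Ii}\nabla_{Jj}\mathscr{F}$ is the restriction of $\partial^2F/\partial x^I_i\partial x^J_j$ to the slice. $(\vec\nabla_I\times\vec\nabla_J)_i=\varepsilon_{ijk}\nabla_{Ij}\nabla_{Jk}$ and $\vec\nabla_I\cdot\vec\nabla_J=\nabla_{Ii}\nabla_{Ji}$. *)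

theory Defs
  imports "HOL-Analysis.Analysis"
begin

text \<open>Only meant for open \<open>S\<close>.\<close>

primrec ck_on ::
  "nat \<Rightarrow> 'a::real_normed_vector set \<Rightarrow> ('a \<Rightarrow> 'b::real_normed_vector) \<Rightarrow> bool" where
  "ck_on 0 S f \<longleftrightarrow> continuous_on S f"
| "ck_on (Suc k) S f \<longleftrightarrow>
     (\<forall>x\<in>S. f differentiable (at x)) \<and> (\<forall>v. ck_on k S (\<lambda>x. frechet_derivative f (at x) v))"

definition smooth_on ::
  "'a::real_normed_vector set \<Rightarrow> ('a \<Rightarrow> 'b::real_normed_vector) \<Rightarrow> bool" where
  "smooth_on S f \<longleftrightarrow> (\<forall>k. ck_on k S f)"

text \<open>A quaternion is a pair of its real part and its imaginary part in \<open>\<real>\<^sup>3\<close>; the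
  library norm on the product type is the quaternion norm. The index type \<open>'n\<close> plays the role of
  \<open>{0,\<dots>,n}\<close>, i.e. \<open>CARD('n) = n + 1\<close>.\<close>

type_synonym quat = "real \<times> (real^3)"
type_synonym 'n conf = "(real^3)^'n"

definition quat_mult :: "quat \<Rightarrow> quat \<Rightarrow> quat" where
  "quat_mult p q =
     (fst p * fst q - snd p \<bullet> snd q,
      fst p *\<^sub>R snd q + fst q *\<^sub>R snd p + cross3 (snd p) (snd q))"

definition quat_cnj :: "quat \<Rightarrow> quat" where
  "quat_cnj q = (fst q, - snd q)"

text \<open>The action \<open>x\<^sup>I \<mapsto> cnj(q) x\<^sup>I q\<close>. The sign \<open>q = -1\<close> acts trivially, so nonzero
  quaternions may be used in place of their classes modulo sign.\<close>

definition act :: "quat \<Rightarrow> 'n::finite conf \<Rightarrow> 'n conf" where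
  "act q x = (\<chi> I. snd (quat_mult (quat_mult (quat_cnj q) (0, x $ I)) q))"

definition C_deg :: "'n::finite conf set" where
  "C_deg = {x. dim (range (\<lambda>I. x $ I)) \<le> 1}"

definition orbit :: "'n::finite conf \<Rightarrow> 'n conf set" where
  "orbit x = {act q x | q. q \<noteq> 0}"

definition ImHP :: "'n::finite conf set set" where
  "ImHP = orbit ` (- C_deg)"

definition ImHP_topology :: "'n::finite conf set topology" where
  "ImHP_topology = topology (\<lambda>U. U \<subseteq> ImHP \<and>
     openin (top_of_set (- C_deg)) {x \<in> - C_deg. orbit x \<in> U})"

lemma istopology_ImHP:
  "istopology (\<lambda>U :: 'n::finite conf set set. U \<subseteq> ImHP \<and>
     openin (top_of_set (- C_deg)) {x \<in> - C_deg. orbit x \<in> U})"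
  unfolding istopology_def
proof (intro conjI allI impI)
  fix U V :: "'n conf set set"
  assume U: "U \<subseteq> ImHP \<and> openin (top_of_set (- C_deg)) {x \<in> - C_deg. orbit x \<in> U}"
    and V: "V \<subseteq> ImHP \<and> openin (top_of_set (- C_deg)) {x \<in> - C_deg. orbit x \<in> V}"
  show "U \<inter> V \<subseteq> ImHP" using U by blast
  have "{x \<in> - C_deg. orbit x \<in> U \<inter> V} =
    {x \<in> - C_deg. orbit x \<in> U} \<inter> {x \<in> - C_deg. orbit x \<in> V}" by blast
  then show "openin (top_of_set (- C_deg)) {x \<in> - C_deg. orbit x \<in> U \<inter> V}"
    using openin_Int[OF conjunct2[OF U] conjunct2[OF V]] by simp
next
  fix \<K> :: "'n conf set set set"
  assume K: "\<forall>U\<in>\<K>. U \<subseteq> ImHP \<and> openin (top_of_set (- C_deg)) {x \<in> - C_deg. orbit x \<in> U}"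
  show "\<Union>\<K> \<subseteq> ImHP" using K by blast
  have "{x \<in> - C_deg. orbit x \<in> \<Union>\<K>} = (\<Union>U\<in>\<K>. {x \<in> - C_deg. orbit x \<in> U})" by blast
  then show "openin (top_of_set (- C_deg)) {x \<in> - C_deg. orbit x \<in> \<Union>\<K>}"
    using K by (simp only:) (intro openin_Union, blast)
qed

lemma openin_ImHP:
  "openin ImHP_topology U \<longleftrightarrow>
     U \<subseteq> ImHP \<and> openin (top_of_set (- C_deg)) {x \<in> - C_deg. orbit x \<in> U}"
  unfolding ImHP_topology_def by (rule topology_inverse'[OF istopology_ImHP, THEN fun_cong])

lemma topspace_ImHP: "topspace ImHP_topology = (ImHP :: 'n::finite conf set set)"
proof (rule antisym)
  show "topspace ImHP_topology \<subseteq> (ImHP :: 'n conf set set)"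
    using openin_topspace[of ImHP_topology] unfolding openin_ImHP by blast
  have "{x \<in> - C_deg. orbit x \<in> ImHP} = (- C_deg :: 'n conf set)"
    by (auto simp: ImHP_def)
  then have "openin ImHP_topology (ImHP :: 'n conf set set)"
    unfolding openin_ImHP by simp
  then show "(ImHP :: 'n conf set set) \<subseteq> topspace ImHP_topology"
    by (rule openin_subset)
qed

lemma quotient_map_orbit: "quotient_map (top_of_set (- C_deg)) ImHP_topology (orbit :: 'n::finite conf \<Rightarrow> _)"
proof -
  have "orbit ` (- C_deg) = (ImHP :: 'n conf set set)"
    by (simp add: ImHP_def)
  then show ?thesis
    unfolding quotient_map_def topspace_ImHP openin_ImHP topspace_euclidean_subtopology by blast
qed

text \<open>The bundle of weight \<open>w\<close> is the quotient of the nondegenerate configurations times \<open>\<real>\<close>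
  by \<open>(x, v) \<sim> (act q x, \<bar>q\<bar>\<^bsup>2w\<^esup> v)\<close>; its points are equivalence classes.\<close>

type_synonym 'n field = "'n conf set \<Rightarrow> ('n conf \<times> real) set"

definition bundle_class :: "real \<Rightarrow> 'n::finite conf \<Rightarrow> real \<Rightarrow> ('n conf \<times> real) set" where
  "bundle_class w x v = {(act q x, norm q powr (2 * w) * v) | q. q \<noteq> 0}"

definition fibre :: "real \<Rightarrow> 'n::finite conf set \<Rightarrow> ('n conf \<times> real) set set" where
  "fibre w p = {bundle_class w x v | x v. x \<in> p}"

text \<open>\<open>rep s x\<close> is the number \<open>v\<close> such that \<open>s\<close> takes the value \<open>[x, v]\<close> at the orbit of \<open>x\<close>.
  As a function on the whole preimage of the domain of \<open>s\<close> this is the homogeneous invariant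
  function \<open>F\<close> corresponding to \<open>s\<close>; its restriction to a slice is the expression of \<open>s\<close> in
  inhomogeneous coordinates.\<close>

definition rep :: "'n::finite field \<Rightarrow> 'n conf \<Rightarrow> real" where
  "rep s x = (THE v. (x, v) \<in> s (orbit x))"

text \<open>\<open>\<Union>S\<close> is the preimage of \<open>S\<close> in the space of configurations. Sections are functions on
  \<open>S\<close>, hence extensional.\<close>

definition sections :: "real \<Rightarrow> 'n::finite conf set set \<Rightarrow> 'n field set" where
  "sections w S =
     {s \<in> extensional S. (\<forall>p\<in>S. s p \<in> fibre w p) \<and> smooth_on (\<Union>S) (rep s)}"

text \<open>The value at \<open>x\<close> of the vector field \<open>a L\<^sub>0 + b \<cdot> L\<close> tangent to the orbits.\<close>

definition orbit_tangent :: "'n::finite conf \<Rightarrow> quat \<Rightarrow> 'n conf" where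
  "orbit_tangent x = (\<lambda>(a, b). \<chi> I. a *\<^sub>R (x $ I) - cross3 b (x $ I))"

text \<open>Slices over \<open>S\<close>: submanifolds of codimension \<open>4\<close> (the dimension of the orbits), given
  locally by four equations whose differential restricts to an isomorphism on the tangent space of
  the orbit, and which meet each orbit at most once.\<close>

definition slice :: "'n::finite conf set set \<Rightarrow> 'n conf set \<Rightarrow> bool" where
  "slice S \<Sigma> \<longleftrightarrow>
     \<Sigma> \<subseteq> \<Union>S \<and>
     (\<forall>\<rho>\<in>\<Sigma>. \<Sigma> \<inter> orbit \<rho> = {\<rho>}) \<and>
     (\<forall>\<rho>\<in>\<Sigma>. \<exists>W (\<phi> :: 'n conf \<Rightarrow> real \<times> (real^3)).
        open W \<and> \<rho> \<in> W \<and> smooth_on W \<phi> \<and> \<Sigma> \<inter> W = {x \<in> W. \<phi> x = 0} \<and>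
        bij (\<lambda>g. frechet_derivative \<phi> (at \<rho>) (orbit_tangent \<rho> g)))"

definition partial :: "'n::finite \<Rightarrow> 3 \<Rightarrow> ('n conf \<Rightarrow> real) \<Rightarrow> 'n conf \<Rightarrow> real" where
  "partial I i F x = frechet_derivative F (at x) (axis I (axis i 1))"

text \<open>The following are to be evaluated at points \<open>\<rho>\<close> of a slice: the derivatives are taken in
  the full space of configurations and then restricted.\<close>

definition nabla :: "'n::finite \<Rightarrow> 'n field \<Rightarrow> 'n conf \<Rightarrow> real^3" where
  "nabla I s \<rho> = (\<chi> i. partial I i (rep s) \<rho>)"

definition nabla2 :: "'n::finite \<Rightarrow> 3 \<Rightarrow> 'n \<Rightarrow> 3 \<Rightarrow> 'n field \<Rightarrow> 'n conf \<Rightarrow> real" where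
  "nabla2 I i J j s \<rho> = partial I i (partial J j (rep s)) \<rho>"

definition nabla_cross :: "'n::finite \<Rightarrow> 'n \<Rightarrow> 'n field \<Rightarrow> 'n conf \<Rightarrow> real^3" where
  "nabla_cross I J s \<rho> = vector
     [nabla2 I 2 J 3 s \<rho> - nabla2 I 3 J 2 s \<rho>,
      nabla2 I 3 J 1 s \<rho> - nabla2 I 1 J 3 s \<rho>,
      nabla2 I 1 J 2 s \<rho> - nabla2 I 2 J 1 s \<rho>]"

definition nabla_dot :: "'n::finite \<Rightarrow> 'n \<Rightarrow> 'n field \<Rightarrow> 'n conf \<Rightarrow> real" where
  "nabla_dot I J s \<rho> = (\<Sum>i\<in>UNIV. nabla2 I i J i s \<rho>)"

definition data_Ia :: "'n::finite conf set set \<Rightarrow> ('n \<Rightarrow> 'n \<Rightarrow> 'n field) set" where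
  "data_Ia S = {M.
     (\<forall>I J. M I J \<in> sections (-1) S) \<and>
     (\<forall>I J. M I J = M J I) \<and>
     (\<forall>I J K. \<forall>\<Sigma>. slice S \<Sigma> \<longrightarrow> (\<forall>\<rho>\<in>\<Sigma>. nabla I (M K J) \<rho> = nabla J (M K I) \<rho>))}"

definition data_Ib :: "'n::finite conf set set \<Rightarrow> 'n field set" where
  "data_Ib S = {u \<in> sections 1 S.
     \<forall>I J. \<forall>\<Sigma>. slice S \<Sigma> \<longrightarrow> (\<forall>\<rho>\<in>\<Sigma>. nabla_cross I J u \<rho> = 0)}"

end

theory Submission
  imports Defs
begin

text \<open>Through every nondegenerate configuration there is a slice, so constraints on slices are
  constraints on the preimage of \<open>S\<close>, and sections are equivariant functions there. Equivariance
  gives the Euler identity \<open>x\<^sup>J\<^sub>j \<partial>\<^sub>J\<^sub>j F = w F\<close> and the rotation identity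
  \<open>x\<^sup>J\<^sub>j \<partial>\<^sub>J\<^sub>k F = x\<^sup>J\<^sub>k \<partial>\<^sub>J\<^sub>j F\<close>.

  For \<open>F = 2 U\<^sub>I\<^sub>J x\<^sup>I \<bullet> x\<^sup>J\<close>, the closedness of \<open>U\<close> and these two identities give
  \<open>\<partial>\<^sub>K\<^sub>k F = 2 U\<^sub>K\<^sub>J x\<^sup>J\<^sub>k\<close>; differentiating once more, the curl vanishes by the rotation
  identity, and the contraction is \<open>4 U\<^sub>K\<^sub>L\<close> by the Euler identity with \<open>w = -1\<close>. Conversely,
  differentiating both identities for \<open>F\<close> of weight 1 with vanishing curl gives
  \<open>x\<^sup>I\<^sub>j (\<partial>\<^sub>J \<bullet> \<partial>\<^sub>I F) = 2 \<partial>\<^sub>J\<^sub>j F\<close>, and a further use of the Euler identity recovers \<open>F\<close>.\<close>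

section \<open>Calculus of smooth functions\<close>

text \<open>On an open set the derivatives of \<open>f\<close> and \<open>g\<close> agree at every
  point of the set, so the induction hypothesis applies to them. This is what allows a function to
  be replaced by a formula valid only on \<open>S\<close>.\<close>

lemma ck_on_cong:
  assumes "open S" "\<And>x. x \<in> S \<Longrightarrow> f x = g x" "ck_on k S f"
  shows "ck_on k S g"
  using assms(2,3)
proof (induction k arbitrary: f g)
  case 0
  then show ?case by (simp cong: continuous_on_cong)
next
  case (Suc k)
  have d: "g differentiable (at x)"
    "frechet_derivative f (at x) = frechet_derivative g (at x)" if "x \<in> S" for x
  proof -
    have "(f has_derivative frechet_derivative f (at x)) (at x)"
      using Suc.prems(2) that by (simp add: frechet_derivative_works)
    then have "(g has_derivative frechet_derivative f (at x)) (at x)"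
      using has_derivative_transform_within_open[OF _ assms(1) that] Suc.prems(1) by blast
    then show "g differentiable (at x)"
      "frechet_derivative f (at x) = frechet_derivative g (at x)"
      by (auto simp: differentiable_def intro: frechet_derivative_at)
  qed
  have "ck_on k S (\<lambda>x. frechet_derivative g (at x) v)" for v
    by (rule Suc.IH[of "\<lambda>x. frechet_derivative f (at x) v"]) (use d Suc.prems(2) in auto)
  with d show ?case by simp
qed

lemma ck_on_differentiable: "ck_on (Suc k) S f \<Longrightarrow> x \<in> S \<Longrightarrow> f differentiable (at x)"
  by simp

lemma ck_on_Suc_imp: "ck_on (Suc k) S f \<Longrightarrow> ck_on k S f"
proof (induction k arbitrary: f)
  case 0
  then show ?case
    by (auto intro!: continuous_at_imp_continuous_on differentiable_imp_continuous_within)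
next
  case (Suc k)
  then show ?case by (metis ck_on.simps(2))
qed

lemma ck_on_const: "ck_on k S (\<lambda>x. c)"
  by (induction k arbitrary: c) simp_all

text \<open>The derivative is the constant map \<open>L\<close>, so every order above the first
  reduces to constants. The coordinates and the equations of slices are of this form.\<close>

lemma ck_on_affine:
  assumes "bounded_linear L"
  shows "ck_on k S (\<lambda>x. L x + c)"
proof -
  have h: "((\<lambda>x. L x + c) has_derivative L) (at x)" for x
    using has_derivative_add_const[OF bounded_linear_imp_has_derivative[OF assms]] .
  then have f: "frechet_derivative (\<lambda>x. L x + c) (at x) = L" for x
    by (metis frechet_derivative_at)
  show ?thesis
  proof (cases k)
    case 0
    then show ?thesis
      using assms by (simp add: continuous_on_add linear_continuous_on)
  next
    case (Suc k)
    then show ?thesis using h by (auto simp: f ck_on_const differentiable_def)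
  qed
qed

lemma frechet_derivative_add_at:
  assumes "f differentiable (at x)" "g differentiable (at x)"
  shows "frechet_derivative (\<lambda>x. f x + g x) (at x) v =
    frechet_derivative f (at x) v + frechet_derivative g (at x) v"
  using has_derivative_add[OF assms[unfolded frechet_derivative_works]]
  by (simp add: frechet_derivative_at[symmetric])

lemma frechet_derivative_mult_at:
  fixes f g :: "'a::real_normed_vector \<Rightarrow> real"
  assumes "f differentiable (at x)" "g differentiable (at x)"
  shows "frechet_derivative (\<lambda>x. f x * g x) (at x) v =
    f x * frechet_derivative g (at x) v + frechet_derivative f (at x) v * g x"
  using has_derivative_mult[OF assms[unfolded frechet_derivative_works]]
  by (simp add: frechet_derivative_at[symmetric])

lemma ck_on_add:
  assumes "open S" "ck_on k S f" "ck_on k S g"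
  shows "ck_on k S (\<lambda>x. f x + g x)"
  using assms(2,3)
proof (induction k arbitrary: f g)
  case 0
  then show ?case by (simp add: continuous_on_add)
next
  case (Suc k)
  have "ck_on k S (\<lambda>x. frechet_derivative (\<lambda>x. f x + g x) (at x) v)" for v
  proof (rule ck_on_cong[OF assms(1)])
    show "ck_on k S (\<lambda>x. frechet_derivative f (at x) v + frechet_derivative g (at x) v)"
      using Suc by simp
  qed (use Suc.prems in \<open>simp add: frechet_derivative_add_at\<close>)
  with Suc.prems show ?case by simp
qed

lemma ck_on_mult:
  fixes f g :: "'a::real_normed_vector \<Rightarrow> real"
  assumes "open S" "ck_on k S f" "ck_on k S g"
  shows "ck_on k S (\<lambda>x. f x * g x)"
  using assms(2,3)
proof (induction k arbitrary: f g)
  case 0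
  then show ?case by (simp add: continuous_on_mult)
next
  case (Suc k)
  have "ck_on k S (\<lambda>x. frechet_derivative (\<lambda>x. f x * g x) (at x) v)" for v
  proof (rule ck_on_cong[OF assms(1)])
    show "ck_on k S (\<lambda>x. f x * frechet_derivative g (at x) v + frechet_derivative f (at x) v * g x)"
      using Suc.prems by (intro ck_on_add[OF assms(1)] Suc.IH) (auto intro: ck_on_Suc_imp)
  qed (use Suc.prems in \<open>simp add: frechet_derivative_mult_at\<close>)
  with Suc.prems show ?case by simp
qed

lemma smooth_on_cong:
  "open S \<Longrightarrow> (\<And>x. x \<in> S \<Longrightarrow> f x = g x) \<Longrightarrow> smooth_on S f \<Longrightarrow> smooth_on S g"
  unfolding smooth_on_def using ck_on_cong by blast

lemma smooth_on_const: "smooth_on S (\<lambda>x. c)"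
  unfolding smooth_on_def by (simp add: ck_on_const)

lemma smooth_on_affine: "bounded_linear L \<Longrightarrow> smooth_on S (\<lambda>x. L x + c)"
  unfolding smooth_on_def by (simp add: ck_on_affine)

lemma smooth_on_add:
  "open S \<Longrightarrow> smooth_on S f \<Longrightarrow> smooth_on S g \<Longrightarrow> smooth_on S (\<lambda>x. f x + g x)"
  unfolding smooth_on_def by (simp add: ck_on_add)

lemma smooth_on_mult:
  fixes f g :: "'a::real_normed_vector \<Rightarrow> real"
  shows "open S \<Longrightarrow> smooth_on S f \<Longrightarrow> smooth_on S g \<Longrightarrow> smooth_on S (\<lambda>x. f x * g x)"
  unfolding smooth_on_def by (simp add: ck_on_mult)

lemma smooth_on_sum:
  assumes "open S" "\<And>i. i \<in> A \<Longrightarrow> smooth_on S (f i)"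
  shows "smooth_on S (\<lambda>x. \<Sum>i\<in>A. f i x)"
  using assms(2)
  by (induction A rule: infinite_finite_induct) (auto intro: smooth_on_const smooth_on_add[OF assms(1)])

lemma smooth_on_differentiable: "smooth_on S f \<Longrightarrow> x \<in> S \<Longrightarrow> f differentiable (at x)"
  unfolding smooth_on_def using ck_on_differentiable by blast

lemma smooth_on_frechet_derivative:
  "smooth_on S f \<Longrightarrow> smooth_on S (\<lambda>x. frechet_derivative f (at x) v)"
  unfolding smooth_on_def using ck_on.simps(2) by blast

lemma smooth_on_continuous_on: "smooth_on S f \<Longrightarrow> continuous_on S f"
  unfolding smooth_on_def using ck_on.simps(1) by blast

lemma frechet_derivative_cong_open:
  assumes "open S" "x \<in> S" "\<And>y. y \<in> S \<Longrightarrow> f y = g y"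
  shows "frechet_derivative f (at x) = frechet_derivative g (at x)"
proof -
  have "(f has_derivative D) (at x) \<longleftrightarrow> (g has_derivative D) (at x)" for D
    using has_derivative_transform_within_open[OF _ assms(1,2)] assms(3) by metis
  then show ?thesis unfolding frechet_derivative_def by simp
qed

section \<open>Symmetry of second derivatives\<close>

lemma mvt_along_line:
  fixes f :: "'a::real_normed_vector \<Rightarrow> real"
  assumes "0 < h" "\<And>s. 0 \<le> s \<Longrightarrow> s \<le> h \<Longrightarrow> f differentiable (at (x + s *\<^sub>R u))"
  shows "\<exists>s. 0 < s \<and> s < h \<and>
    f (x + h *\<^sub>R u) - f x = h * frechet_derivative f (at (x + s *\<^sub>R u)) u"
proof -
  have d: "((\<lambda>s. f (x + s *\<^sub>R u)) has_real_derivative frechet_derivative f (at (x + s *\<^sub>R u)) u) (at s)"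
    if "0 \<le> s" "s \<le> h" for s
  proof -
    have F: "(f has_derivative frechet_derivative f (at (x + s *\<^sub>R u))) (at (x + s *\<^sub>R u))"
      using assms(2)[OF that] by (simp add: frechet_derivative_works)
    have "((\<lambda>s. x + s *\<^sub>R u) has_derivative (\<lambda>t. t *\<^sub>R u)) (at s)"
      by (auto intro!: derivative_eq_intros)
    from has_derivative_compose[OF this F]
    have "((\<lambda>s. f (x + s *\<^sub>R u)) has_derivative
        (\<lambda>t. frechet_derivative f (at (x + s *\<^sub>R u)) (t *\<^sub>R u))) (at s)" .
    then show ?thesis
      using linear_cmul[OF linear_frechet_derivative[OF assms(2)[OF that]]]
      by (simp add: has_field_derivative_def mult_commute_abs)
  qed
  show ?thesis using MVT2[OF assms(1) d] by auto
qed

text \<open>The left-hand side is symmetric in \<open>u\<close> and \<open>v\<close>, which forces the mixed derivatives to agree.\<close>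

lemma second_difference_mvt:
  fixes f :: "'a::real_normed_vector \<Rightarrow> real"
  assumes f: "smooth_on S f" and h: "0 < h"
    and S: "\<And>s t. 0 \<le> s \<Longrightarrow> s \<le> h \<Longrightarrow> 0 \<le> t \<Longrightarrow> t \<le> h \<Longrightarrow> x + s *\<^sub>R u + t *\<^sub>R v \<in> S"
  shows "\<exists>s t. 0 < s \<and> s < h \<and> 0 < t \<and> t < h \<and>
    f (x + h *\<^sub>R u + h *\<^sub>R v) - f (x + h *\<^sub>R u) - f (x + h *\<^sub>R v) + f x =
    h * (h * frechet_derivative (\<lambda>y. frechet_derivative f (at y) u) (at (x + s *\<^sub>R u + t *\<^sub>R v)) v)"
proof -
  let ?D = "\<lambda>y. frechet_derivative f (at y) u"
  \<comment> \<open>The second difference is the increment of \<open>?g\<close> along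
    \<open>u\<close>. The mean value theorem in direction \<open>u\<close> turns it into an
    increment of \<open>?D\<close> along \<open>v\<close>, to which the theorem applies
    again.\<close>
  let ?g = "\<lambda>y. f (y + h *\<^sub>R v) - f y"
  have hd: "(?g has_derivative
      (\<lambda>w. frechet_derivative f (at (y + h *\<^sub>R v)) w - frechet_derivative f (at y) w)) (at y)"
    if y: "y \<in> S" "y + h *\<^sub>R v \<in> S" for y
  proof -
    have "((\<lambda>y. f (y + h *\<^sub>R v)) has_derivative frechet_derivative f (at (y + h *\<^sub>R v))) (at y)"
    proof (rule has_derivative_compose[where f = "\<lambda>y. y + h *\<^sub>R v" and f' = "\<lambda>w. w"])
      show "((\<lambda>y. y + h *\<^sub>R v) has_derivative (\<lambda>w. w)) (at y)"
        by (auto intro!: derivative_eq_intros)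
    qed (use smooth_on_differentiable[OF f y(2)] in \<open>simp add: frechet_derivative_works\<close>)
    moreover have "(f has_derivative frechet_derivative f (at y)) (at y)"
      using smooth_on_differentiable[OF f y(1)] by (simp add: frechet_derivative_works)
    ultimately show ?thesis by (rule has_derivative_diff)
  qed
  have S0: "x + s *\<^sub>R u \<in> S" if "0 \<le> s" "s \<le> h" for s
    using S[of s 0] that h by simp
  have "?g differentiable (at (x + s *\<^sub>R u))" if "0 \<le> s" "s \<le> h" for s
    using hd[OF S0[OF that]] S[OF that, of h] h by (auto simp: differentiable_def)
  from mvt_along_line[of h ?g x u, OF h this] obtain s where s: "0 < s" "s < h"
    and e1: "?g (x + h *\<^sub>R u) - ?g x = h * frechet_derivative ?g (at (x + s *\<^sub>R u)) u"
    by blast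
  have "frechet_derivative ?g (at (x + s *\<^sub>R u)) u = ?D (x + s *\<^sub>R u + h *\<^sub>R v) - ?D (x + s *\<^sub>R u)"
    by (subst frechet_derivative_at[OF hd, symmetric]) (use S0[of s] S[of s h] s h in auto)
  moreover have "?D differentiable (at (x + s *\<^sub>R u + t *\<^sub>R v))" if "0 \<le> t" "t \<le> h" for t
    using smooth_on_differentiable[OF smooth_on_frechet_derivative[OF f] S] that s by simp
  from mvt_along_line[of h ?D "x + s *\<^sub>R u" v, OF h this] obtain t where t: "0 < t" "t < h"
    and e2: "?D (x + s *\<^sub>R u + h *\<^sub>R v) - ?D (x + s *\<^sub>R u) =
      h * frechet_derivative ?D (at (x + s *\<^sub>R u + t *\<^sub>R v)) v"
    by blast
  ultimately show ?thesis using e1 s t by (intro exI[of _ s] exI[of _ t]) simp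
qed

text \<open>If the mixed derivatives differed at \<open>x\<close>, by continuity they would stay
  apart on a small parallelogram at \<open>x\<close>. But up to the factor \<open>h * h\<close> both
  represent the same second difference at suitable points of it.\<close>

lemma frechet_derivative_commute:
  fixes f :: "'a::real_normed_vector \<Rightarrow> real"
  assumes "open S" "x \<in> S" and f: "smooth_on S f"
  shows "frechet_derivative (\<lambda>y. frechet_derivative f (at y) u) (at x) v =
    frechet_derivative (\<lambda>y. frechet_derivative f (at y) v) (at x) u" (is "?A x = ?B x")
proof (rule ccontr)
  assume ne: "?A x \<noteq> ?B x"
  define e where "e = \<bar>?A x - ?B x\<bar> / 2"
  have e: "e > 0" using ne by (simp add: e_def)
  have "continuous_on S ?A" "continuous_on S ?B"
    using f by (auto intro!: smooth_on_continuous_on smooth_on_frechet_derivative)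
  then have "isCont ?A x" "isCont ?B x"
    using assms(1,2) by (auto simp: continuous_on_eq_continuous_at)
  then obtain d1 d2 where d1: "d1 > 0" "\<And>y. dist y x < d1 \<Longrightarrow> dist (?A y) (?A x) < e"
    and d2: "d2 > 0" "\<And>y. dist y x < d2 \<Longrightarrow> dist (?B y) (?B x) < e"
    using e unfolding continuous_at_eps_delta by metis
  obtain d3 where d3: "d3 > 0" "ball x d3 \<subseteq> S" using assms(1,2) open_contains_ball by blast
  define d where "d = Min {d1, d2, d3}"
  have d: "d > 0" "d \<le> d1" "d \<le> d2" "d \<le> d3" using d1 d2 d3 by (auto simp: d_def)
  \<comment> \<open>With this side length the parallelogram spanned by \<open>h *\<^sub>R u\<close>
    and \<open>h *\<^sub>R v\<close> stays within distance \<open>d\<close> of \<open>x\<close>; the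
    summand 1 covers the case that both directions vanish.\<close>
  define h where "h = d / (norm u + norm v + 1)"
  have pos: "norm u + norm v + 1 > 0" by (simp add: add_nonneg_pos)
  have h: "h > 0" using d pos by (simp add: h_def)
  have near: "dist (x + s *\<^sub>R u + t *\<^sub>R v) x < d" if "0 \<le> s" "s \<le> h" "0 \<le> t" "t \<le> h" for s t
  proof -
    have "dist (x + s *\<^sub>R u + t *\<^sub>R v) x = norm (s *\<^sub>R u + t *\<^sub>R v)" by (simp add: dist_norm add.assoc)
    also have "\<dots> \<le> s * norm u + t * norm v"
      using norm_triangle_ineq[of "s *\<^sub>R u" "t *\<^sub>R v"] that by simp
    also have "\<dots> \<le> h * norm u + h * norm v"
      using that by (intro add_mono mult_right_mono) auto
    also have "\<dots> < h * (norm u + norm v + 1)" using h by (simp add: algebra_simps)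
    also have "\<dots> = d" using pos by (simp add: h_def)
    finally show ?thesis .
  qed
  have S: "x + s *\<^sub>R u + t *\<^sub>R v \<in> S" if "0 \<le> s" "s \<le> h" "0 \<le> t" "t \<le> h" for s t
    using near[OF that] d(4) d3(2) by (auto simp: dist_commute)
  have S': "x + s *\<^sub>R v + t *\<^sub>R u \<in> S" if "0 \<le> s" "s \<le> h" "0 \<le> t" "t \<le> h" for s t
    using S[OF that(3,4,1,2)] by (simp add: add.assoc add.commute[of "s *\<^sub>R v"])
  from second_difference_mvt[OF f h S] obtain s t where st: "0 < s" "s < h" "0 < t" "t < h"
    "f (x + h *\<^sub>R u + h *\<^sub>R v) - f (x + h *\<^sub>R u) - f (x + h *\<^sub>R v) + f x =
      h * (h * ?A (x + s *\<^sub>R u + t *\<^sub>R v))" by blast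
  from second_difference_mvt[OF f h S'] obtain s' t' where st': "0 < s'" "s' < h" "0 < t'" "t' < h"
    "f (x + h *\<^sub>R v + h *\<^sub>R u) - f (x + h *\<^sub>R v) - f (x + h *\<^sub>R u) + f x =
      h * (h * ?B (x + s' *\<^sub>R v + t' *\<^sub>R u))" by blast
  have "h * (h * ?A (x + s *\<^sub>R u + t *\<^sub>R v)) = h * (h * ?B (x + s' *\<^sub>R v + t' *\<^sub>R u))"
    using st(5) st'(5) by (simp add: algebra_simps)
  then have eq: "?A (x + s *\<^sub>R u + t *\<^sub>R v) = ?B (x + t' *\<^sub>R u + s' *\<^sub>R v)"
    using h by (simp add: algebra_simps)
  have A: "dist (?A (x + s *\<^sub>R u + t *\<^sub>R v)) (?A x) < e"
    using d1(2) near[of s t] st d by simp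
  have B: "dist (?B (x + t' *\<^sub>R u + s' *\<^sub>R v)) (?B x) < e"
    using d2(2) near[of t' s'] st' d by simp
  have False if "dist p a < \<bar>a - b\<bar> / 2" "dist q b < \<bar>a - b\<bar> / 2" "p = q" for p q a b :: real
    using that by (auto simp: dist_real_def abs_if split: if_splits)
  from this[OF A[unfolded e_def] B[unfolded e_def] eq] show False .
qed

section \<open>The action of the quaternions\<close>

text \<open>The action on a single vector, cnj(q) v q with the quaternion products multiplied out: a
  rotation times the scaling by the squared norm of \<open>q\<close>.\<close>

definition rot :: "quat \<Rightarrow> real^3 \<Rightarrow> real^3" where
  "rot q v = (fst q ^ 2 - snd q \<bullet> snd q) *\<^sub>R v + (2 * (snd q \<bullet> v)) *\<^sub>R snd q
     - (2 * fst q) *\<^sub>R cross3 (snd q) v"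

lemma norm_quat_sq: "norm q ^ 2 = fst q ^ 2 + snd q \<bullet> snd q" for q :: quat
  by (simp add: norm_prod_def power2_norm_eq_inner)

lemma act_nth: "act q x $ I = rot q (x $ I)"
  by (simp add: act_def rot_def quat_mult_def quat_cnj_def vec_eq_iff forall_3 cross_components
      inner_vec_def sum_3 algebra_simps power2_eq_square)

lemma linear_rot: "linear (rot q)"
  by (rule linearI)
    (simp_all add: rot_def inner_add_right cross_add_right cross_mult_right algebra_simps)

lemma rot_inner: "rot q v \<bullet> rot q w = norm q ^ 4 * (v \<bullet> w)"
proof -
  obtain a u where q: "q = (a, u)" by (cases q)
  \<comment> \<open>Skewness of the cross product brings all triple products to one form, in which
    the terms odd in \<open>a\<close> cancel.\<close>
  have skew: "w \<bullet> cross3 u v = - (v \<bullet> cross3 u w)" "cross3 u v \<bullet> w = - (v \<bullet> cross3 u w)"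
    by (simp_all add: inner_vec_def sum_3 cross_components algebra_simps)
  have "norm q ^ 4 = (norm q ^ 2) ^ 2" by simp
  then have n: "norm q ^ 4 = (a ^ 2 + u \<bullet> u) ^ 2"
    unfolding norm_quat_sq by (simp only: q fst_conv snd_conv)
  show ?thesis
    unfolding n
    by (simp add: q rot_def inner_add_left inner_add_right inner_diff_left inner_diff_right
        dot_cross_self dot_cross skew inner_commute[of v u] inner_commute[of w u]
        inner_commute[of w v])
      (simp add: algebra_simps power2_eq_square)
qed

lemma rot_cross: "cross3 (rot q v) (rot q w) = norm q ^ 2 *\<^sub>R rot q (cross3 v w)"
  unfolding norm_quat_sq vec_eq_iff forall_3
  by (simp add: rot_def inner_vec_def sum_3 cross_components algebra_simps power2_eq_square)

text \<open>Since cnj(p) cnj(q) v q p = cnj(qp) v (qp), this is a right action, hence the reversed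
  product.\<close>

lemma rot_rot: "rot p (rot q v) = rot (quat_mult q p) v"
  unfolding vec_eq_iff forall_3
  by (simp add: rot_def quat_mult_def inner_vec_def sum_3 cross_components algebra_simps power2_eq_square)

text \<open>Where \<open>rot_inner\<close> expresses orthogonality of the columns of the matrix of
  \<open>rot q\<close>, this is orthogonality of its rows, needed when derivatives along rotated
  axes are contracted.\<close>

lemma rot_dual: "(\<Sum>i\<in>UNIV. rot q (axis i 1) $ j * rot q (axis i 1) $ k) = (if j = k then norm q ^ 4 else 0)"
proof -
  have n: "norm q ^ 4 = (norm q ^ 2) ^ 2" by simp
  have "\<forall>j k. (\<Sum>i\<in>UNIV. rot q (axis i 1) $ j * rot q (axis i 1) $ k) = (if j = k then norm q ^ 4 else 0)"
    unfolding n norm_quat_sq forall_3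
    by (simp add: rot_def inner_vec_def sum_3 cross_components axis_def algebra_simps power2_eq_square)
  then show ?thesis by blast
qed

lemma norm_quat_mult: "norm (quat_mult p q) = norm p * norm q"
proof (rule power2_eq_imp_eq)
  show "norm (quat_mult p q) ^ 2 = (norm p * norm q) ^ 2"
    unfolding power_mult_distrib norm_quat_sq
    by (simp add: quat_mult_def inner_vec_def sum_3 cross_components algebra_simps power2_eq_square)
qed auto

lemma quat_mult_nonzero: "p \<noteq> 0 \<Longrightarrow> q \<noteq> 0 \<Longrightarrow> quat_mult p q \<noteq> 0"
  by (metis norm_eq_zero norm_quat_mult mult_eq_0_iff)

lemma rot_norm: "norm (rot q v) = norm q ^ 2 * norm v"
proof (rule power2_eq_imp_eq)
  show "norm (rot q v) ^ 2 = (norm q ^ 2 * norm v) ^ 2"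
    unfolding power_mult_distrib power2_norm_eq_inner[of "rot q v"] rot_inner power2_norm_eq_inner[of v]
    by simp
qed auto

lemma rot_real: "rot (a, 0) v = a ^ 2 *\<^sub>R v"
  by (simp add: rot_def)

definition quat_inv :: "quat \<Rightarrow> quat" where
  "quat_inv q = inverse (norm q ^ 2) *\<^sub>R quat_cnj q"

lemma quat_mult_inv:
  assumes "q \<noteq> 0"
  shows "quat_mult q (quat_inv q) = (1, 0)"
proof -
  from assms have "inverse (norm q ^ 2) * (fst q ^ 2 + snd q \<bullet> snd q) = 1"
    unfolding norm_quat_sq[symmetric] by simp
  then show ?thesis
    by (simp add: quat_mult_def quat_inv_def quat_cnj_def cross_mult_right algebra_simps power2_eq_square)
qed

lemma quat_inv_nonzero: "q \<noteq> 0 \<Longrightarrow> quat_inv q \<noteq> 0"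
  by (auto simp: quat_inv_def quat_cnj_def prod_eq_iff)

lemma act_act: "act p (act q x) = act (quat_mult q p) x"
  by (simp add: vec_eq_iff act_nth rot_rot)

lemma act_one: "act (1, 0) x = x"
  by (simp add: vec_eq_iff act_nth rot_real)

lemma act_inv: "q \<noteq> 0 \<Longrightarrow> act (quat_inv q) (act q x) = x"
  by (simp add: act_act quat_mult_inv act_one)

lemma linear_act: "linear (act q)"
  by (rule linearI) (simp_all add: vec_eq_iff act_nth linear_add[OF linear_rot] linear_cmul[OF linear_rot])

lemma act_axis: "act q (axis I v) = axis I (rot q v)"
  by (auto simp: vec_eq_iff[where 'b = "'a::finite"] act_nth axis_def linear_0[OF linear_rot])

text \<open>The action is quadratic in the quaternion, so its expansion along a line through 1
  terminates. The linear term is twice the tangent vector because the quaternion multiplies from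
  both sides.\<close>

lemma act_near_one:
  "act (1 + t * a, t *\<^sub>R b) x = x + (2 * t) *\<^sub>R orbit_tangent x (a, b) + t ^ 2 *\<^sub>R act (a, b) x"
proof (subst vec_eq_iff, rule allI)
  fix I
  show "act (1 + t * a, t *\<^sub>R b) x $ I =
    (x + (2 * t) *\<^sub>R orbit_tangent x (a, b) + t ^ 2 *\<^sub>R act (a, b) x) $ I"
    by (simp add: act_nth rot_def orbit_tangent_def cross_mult_left algebra_simps power2_eq_square)
qed

text \<open>Two vectors with nonzero cross product are independent; if all cross products vanish,
  every vector lies on the line of any nonzero one. In this polynomial form, openness and invariance
  of nondegeneracy are easy.\<close>

lemma C_deg_iff: "x \<in> C_deg \<longleftrightarrow> (\<forall>A B. cross3 (x $ A) (x $ B) = 0)"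
proof
  assume "x \<in> C_deg"
  then have d: "dim (range (\<lambda>I. x $ I)) \<le> 1" by (simp add: C_deg_def)
  show "\<forall>A B. cross3 (x $ A) (x $ B) = 0"
  proof (intro allI, rule ccontr)
    fix A B assume ne: "cross3 (x $ A) (x $ B) \<noteq> 0"
    then have "x $ A \<noteq> x $ B" by auto
    moreover have "independent {x $ A, x $ B}"
    proof -
      have "x $ A \<notin> span {x $ B}"
        using ne by (auto simp: span_singleton cross_mult_left)
      moreover have "x $ B \<noteq> 0" using ne by auto
      ultimately show ?thesis by (simp add: independent_insert)
    qed
    ultimately have "2 \<le> dim (range (\<lambda>I. x $ I))"
      using independent_card_le_dim[of "{x $ A, x $ B}" "range (\<lambda>I. x $ I)"] by simp
    with d show False by simp
  qed
next
  assume c: "\<forall>A B. cross3 (x $ A) (x $ B) = 0"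
  show "x \<in> C_deg"
  proof (cases "\<exists>A. x $ A \<noteq> 0")
    case False
    then have "range (\<lambda>I. x $ I) \<subseteq> {0}" by auto
    then have "dim (range (\<lambda>I. x $ I)) = 0" using dim_eq_0 by blast
    then show ?thesis by (simp add: C_deg_def del: dim_eq_0)
  next
    case True
    then obtain A where A: "x $ A \<noteq> 0" by blast
    have "x $ B \<in> span {x $ A}" for B
    proof -
      have "collinear {0, x $ A, x $ B}" using c cross_eq_0 by blast
      then show ?thesis using A by (auto simp: collinear_lemma span_singleton intro: exI[of _ 0])
    qed
    then have "dim (range (\<lambda>I. x $ I)) \<le> dim {x $ A}"
      by (intro dim_mono) auto
    then show ?thesis using A by (simp add: C_deg_def dim_singleton)
  qed
qed

lemma open_nondeg: "open (- C_deg :: 'n::finite conf set)"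
proof -
  have "- C_deg = (\<Union>A B. {x :: 'n conf. cross3 (x $ A) (x $ B) \<noteq> 0})"
    by (auto simp: C_deg_iff)
  moreover have "open {x :: 'n conf. cross3 (x $ A) (x $ B) \<noteq> 0}" for A B
    by (intro open_Collect_neq continuous_on_cross continuous_intros)
  ultimately show ?thesis by (simp add: open_UN)
qed

lemma act_nondeg:
  assumes "x \<notin> C_deg" "q \<noteq> 0"
  shows "act q x \<notin> C_deg"
proof -
  obtain A B where "cross3 (x $ A) (x $ B) \<noteq> 0" using assms(1) by (auto simp: C_deg_iff)
  then have "rot q (cross3 (x $ A) (x $ B)) \<noteq> 0"
    using assms(2) rot_norm[of q "cross3 (x $ A) (x $ B)"] by auto
  then have "cross3 (act q x $ A) (act q x $ B) \<noteq> 0"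
    using assms(2) by (simp add: act_nth rot_cross)
  then show ?thesis by (auto simp: C_deg_iff)
qed

lemma orbit_self: "x \<in> orbit x"
proof -
  have "x = act (1, 0) x \<and> (1, 0) \<noteq> (0 :: quat)" by (simp add: act_one zero_prod_def)
  then show ?thesis unfolding orbit_def by blast
qed

lemma orbit_act: "q \<noteq> 0 \<Longrightarrow> orbit (act q x) = orbit x"
proof (intro equalityI subsetI)
  fix y assume q: "q \<noteq> 0" and "y \<in> orbit (act q x)"
  then show "y \<in> orbit x"
    unfolding orbit_def using act_act quat_mult_nonzero by blast
next
  fix y assume q: "q \<noteq> 0" and "y \<in> orbit x"
  then obtain p where "p \<noteq> 0" "y = act p x" by (auto simp: orbit_def)
  then have "y = act (quat_mult (quat_inv q) p) (act q x)" "quat_mult (quat_inv q) p \<noteq> 0"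
    using q by (simp_all add: act_act[symmetric] act_inv quat_mult_nonzero quat_inv_nonzero)
  then show "y \<in> orbit (act q x)" unfolding orbit_def by blast
qed

section \<open>Partial derivatives of equivariant functions\<close>

lemma partial_cong_open:
  "open S \<Longrightarrow> x \<in> S \<Longrightarrow> (\<And>y. y \<in> S \<Longrightarrow> F y = G y) \<Longrightarrow> partial I i F x = partial I i G x"
  unfolding partial_def using frechet_derivative_cong_open[of S x F G] by simp

lemma smooth_on_partial: "smooth_on S F \<Longrightarrow> smooth_on S (partial I i F)"
  unfolding partial_def by (rule smooth_on_frechet_derivative)

lemma partial_commute:
  assumes "open S" "x \<in> S" "smooth_on S F"
  shows "partial I i (partial J j F) x = partial J j (partial I i F) x"
  unfolding partial_def by (rule frechet_derivative_commute[OF assms])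

lemma conf_expand: "v = (\<Sum>I\<in>UNIV. \<Sum>i\<in>UNIV. v $ I $ i *\<^sub>R axis I (axis i 1))"
  for v :: "'n::finite conf"
proof (intro vec_eq_iff[THEN iffD2] allI)
  fix J j
  show "v $ J $ j = (\<Sum>I\<in>UNIV. \<Sum>i\<in>UNIV. v $ I $ i *\<^sub>R axis I (axis i 1)) $ J $ j"
  proof -
    have "(\<Sum>I\<in>UNIV. \<Sum>i\<in>UNIV. v $ I $ i *\<^sub>R axis I (axis i 1 :: real^3)) $ J $ j =
      (\<Sum>I\<in>UNIV. \<Sum>i\<in>UNIV. if I = J then (if i = j then v $ I $ i else 0) else 0)"
      unfolding sum_component by (intro sum.cong refl) (auto simp: axis_def)
    also have "\<dots> = (\<Sum>I\<in>UNIV. if I = J then v $ I $ j else 0)"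
      by (intro sum.cong refl) simp
    also have "\<dots> = v $ J $ j" by simp
    finally show ?thesis by simp
  qed
qed

lemma frechet_derivative_partials:
  assumes "F differentiable (at x)"
  shows "frechet_derivative F (at x) v = (\<Sum>I\<in>UNIV. \<Sum>i\<in>UNIV. v $ I $ i * partial I i F x)"
proof -
  have L: "linear (frechet_derivative F (at x))" using assms by (rule linear_frechet_derivative)
  show ?thesis
    by (subst conf_expand[of v])
      (simp add: linear_sum[OF L] linear_cmul[OF L] partial_def o_def)
qed

lemma bounded_linear_coord: "bounded_linear (\<lambda>x :: 'n::finite conf. x $ J $ j)"
  by (rule bounded_linear_compose[OF bounded_linear_vec_nth bounded_linear_vec_nth])

lemma partial_coord: "partial I i (\<lambda>x. x $ J $ j) x = (if I = J \<and> i = j then 1 else 0)"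
proof -
  have "frechet_derivative (\<lambda>x :: 'a conf. x $ J $ j) (at x) = (\<lambda>x. x $ J $ j)"
    using frechet_derivative_at[OF bounded_linear_imp_has_derivative[OF bounded_linear_coord]] by metis
  then show ?thesis by (simp add: partial_def axis_def)
qed

lemma coord_differentiable: "(\<lambda>x :: 'n::finite conf. x $ J $ j) differentiable (at x)"
  using bounded_linear_imp_has_derivative[OF bounded_linear_coord] by (auto simp: differentiable_def)

lemma smooth_on_coord: "smooth_on S (\<lambda>x :: 'n::finite conf. x $ J $ j)"
  using smooth_on_affine[OF bounded_linear_coord, where c = 0] by simp

lemma partial_const: "partial I i (\<lambda>x. c) x = 0"
  by (simp add: partial_def)

lemma partial_mult:
  assumes "F differentiable (at x)" "G differentiable (at x)"
  shows "partial I i (\<lambda>x. F x * G x) x = F x * partial I i G x + partial I i F x * G x"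
  unfolding partial_def by (rule frechet_derivative_mult_at[OF assms])

lemma partial_cmult:
  assumes "F differentiable (at x)"
  shows "partial I i (\<lambda>x. c * F x) x = c * partial I i F x"
  using partial_mult[of "\<lambda>x. c" x F] assms by (simp add: partial_const)

lemma partial_sum:
  assumes "finite A" "\<And>a. a \<in> A \<Longrightarrow> F a differentiable (at x)"
  shows "partial I i (\<lambda>x. \<Sum>a\<in>A. F a x) x = (\<Sum>a\<in>A. partial I i (F a) x)"
  using assms
proof (induction A)
  case (insert a A)
  have "(\<lambda>x. \<Sum>a\<in>A. F a x) differentiable (at x)"
    using insert by (intro differentiable_sum) auto
  with insert show ?case by (simp add: partial_def frechet_derivative_add_at)
qed (simp add: partial_const)

text \<open>The product rule for the shape in which the Euler and rotation identities and the
  quadratic form are differentiated below; the first term comes from the explicit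
  coordinate.\<close>

lemma partial_sum_coord_mult:
  assumes "\<And>J. G J differentiable (at x)"
  shows "partial L l (\<lambda>x. \<Sum>J\<in>UNIV. x $ J $ j * G J x) x =
    (if l = j then G L x else 0) + (\<Sum>J\<in>UNIV. x $ J $ j * partial L l (G J) x)"
proof -
  have "partial L l (\<lambda>x. \<Sum>J\<in>UNIV. x $ J $ j * G J x) x =
    (\<Sum>J\<in>UNIV. x $ J $ j * partial L l (G J) x + (if J = L \<and> l = j then G J x else 0))"
    using assms
    by (auto simp: partial_sum coord_differentiable partial_mult partial_coord intro!: sum.cong)
  also have "\<dots> = (\<Sum>J\<in>UNIV. x $ J $ j * partial L l (G J) x) + (\<Sum>J\<in>UNIV. if J = L \<and> l = j then G J x else 0)"
    by (rule sum.distrib)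
  also have "(\<Sum>J\<in>UNIV. if J = L \<and> l = j then G J x else 0) = (if l = j then G L x else 0)"
    by auto
  finally show ?thesis by simp
qed

section \<open>Equivariant functions and their infinitesimal identities\<close>

definition equivariant :: "real \<Rightarrow> 'n::finite conf set \<Rightarrow> ('n conf \<Rightarrow> real) \<Rightarrow> bool" where
  "equivariant w D F \<longleftrightarrow> (\<forall>x\<in>D. \<forall>q. q \<noteq> 0 \<longrightarrow> F (act q x) = norm q powr (2 * w) * F x)"

locale invariant_domain =
  fixes D :: "'n::finite conf set"
  assumes open_D: "open D"
    and act_D: "x \<in> D \<Longrightarrow> q \<noteq> 0 \<Longrightarrow> act q x \<in> D"
begin

text \<open>Differentiate the equivariance law at t = 0 along the quaternions 1 + t(a, b). The
  factor 2 from \<open>act_near_one\<close> cancels against the 2 in the exponent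
  \<open>2 * w\<close>.\<close>

lemma infinitesimal:
  assumes "equivariant w D F" "F differentiable (at x)" "x \<in> D"
  shows "frechet_derivative F (at x) (orbit_tangent x (a, b)) = a * w * F x"
proof -
  let ?q = "\<lambda>t. (1 + t * a, t *\<^sub>R b) :: quat"
  let ?n = "\<lambda>t. (1 + t * a) ^ 2 + t ^ 2 * (b \<bullet> b)"
  let ?F' = "frechet_derivative F (at x)"
  have L: "linear ?F'" using assms(2) by (rule linear_frechet_derivative)
  have F: "(F has_derivative ?F') (at x)" using assms(2) by (simp add: frechet_derivative_works)
  have act: "((\<lambda>t. act (?q t) x) has_derivative (\<lambda>s. s *\<^sub>R (2 *\<^sub>R orbit_tangent x (a, b)))) (at 0)"
    unfolding act_near_one by (auto intro!: derivative_eq_intros)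
  have c: "((\<lambda>t. F (act (?q t) x)) has_derivative (\<lambda>s. ?F' (s *\<^sub>R (2 *\<^sub>R orbit_tangent x (a, b))))) (at 0)"
    by (rule has_derivative_compose[OF act]) (use F in \<open>simp add: act_one\<close>)
  have sc: "?F' (s *\<^sub>R (2 *\<^sub>R v)) = s * (2 * ?F' v)" for s v
    by (simp only: linear_cmul[OF L] real_scaleR_def)
  have d1: "((\<lambda>t. F (act (?q t) x)) has_derivative (\<lambda>s. s * (2 * ?F' (orbit_tangent x (a, b))))) (at 0)"
    using c unfolding sc .
  \<comment> \<open>\<open>?n t\<close> is the squared norm of \<open>?q t\<close>. It may vanish
    for some \<open>t\<close>, where equivariance says nothing, but not near 0, and only that
    matters for the derivative at 0.\<close>
  have ne: "eventually (\<lambda>t. ?n t \<noteq> 0) (at 0)"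
  proof -
    have "isCont ?n 0" by (intro continuous_intros)
    then have "(?n \<longlongrightarrow> ?n 0) (at 0)" unfolding isCont_def .
    then show ?thesis by (rule tendsto_imp_eventually_ne) simp
  qed
  have eq: "norm (?q t) powr (2 * w) = ?n t powr w" if "?n t \<noteq> 0" for t
  proof -
    have "norm (?q t) ^ 2 = ?n t"
      unfolding norm_quat_sq by (simp add: power2_eq_square)
    moreover from this that have "norm (?q t) \<noteq> 0" by (metis power_zero_numeral)
    then have "norm (?q t) > 0" using norm_ge_zero[of "?q t"] by linarith
    then have "norm (?q t) powr (2 * w) = (norm (?q t) ^ 2) powr w"
      by (subst powr_powr[symmetric]) (simp only: powr_numeral)
    ultimately show ?thesis by (simp only:)
  qed
  have "((\<lambda>t. ?n t powr w * F x) has_derivative (\<lambda>s. s * (2 * (a * w * F x)))) (at 0)"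
    by (auto intro!: derivative_eq_intros)
  then have "((\<lambda>t. F (act (?q t) x)) has_derivative (\<lambda>s. s * (2 * (a * w * F x)))) (at 0)"
  proof (rule has_derivative_transform_eventually)
    show "eventually (\<lambda>t. ?n t powr w * F x = F (act (?q t) x)) (at 0)"
      using ne
    proof eventually_elim
      case (elim t)
      then have "?q t \<noteq> 0" by (auto simp: zero_prod_def)
      with assms(1,3) eq[OF elim] show ?case by (simp add: equivariant_def)
    qed
  qed (simp_all add: act_one)
  from has_derivative_unique[OF d1 this] show ?thesis by (auto dest: fun_cong[of _ _ 1])
qed

lemma euler:
  assumes "equivariant w D F" "F differentiable (at x)" "x \<in> D"
  shows "(\<Sum>J\<in>UNIV. \<Sum>j\<in>UNIV. x $ J $ j * partial J j F x) = w * F x"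
proof -
  have "orbit_tangent x (1, 0) = x" by (simp add: orbit_tangent_def vec_eq_iff)
  with infinitesimal[OF assms, of 1 0] frechet_derivative_partials[OF assms(2), of x]
  show ?thesis by simp
qed

text \<open>Pure rotations carry no weight, so the derivative along them vanishes. The three basis
  vectors as rotation axes give the three pairs of distinct components.\<close>

lemma rotation_invariance:
  assumes "equivariant w D F" "F differentiable (at x)" "x \<in> D"
  shows "(\<Sum>J\<in>UNIV. x $ J $ j * partial J k F x) = (\<Sum>J\<in>UNIV. x $ J $ k * partial J j F x)"
proof -
  have "(\<Sum>J\<in>UNIV. \<Sum>j\<in>UNIV. cross3 b (x $ J) $ j * partial J j F x) = 0" for b
    using infinitesimal[OF assms, of 0 b] frechet_derivative_partials[OF assms(2), of "orbit_tangent x (0, b)"]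
    by (simp add: orbit_tangent_def sum_negf)
  from this[of "axis 1 1"] this[of "axis 2 1"] this[of "axis 3 1"]
  have "\<forall>j k. (\<Sum>J\<in>UNIV. x $ J $ j * partial J k F x) = (\<Sum>J\<in>UNIV. x $ J $ k * partial J j F x)"
    unfolding forall_3 by (simp add: sum_3 cross_components axis_def sum.distrib sum_negf sum_subtractf)
  then show ?thesis by blast
qed

end

section \<open>Contractions and quadratic forms\<close>

lemma sum_rotate:
  "(\<Sum>a\<in>A. \<Sum>b\<in>B. \<Sum>c\<in>C. f a b c) = (\<Sum>c\<in>C. \<Sum>a\<in>A. \<Sum>b\<in>B. f a b c)"
  for f :: "'a \<Rightarrow> 'b \<Rightarrow> 'c \<Rightarrow> 'd::comm_monoid_add"
proof -
  have "(\<Sum>a\<in>A. \<Sum>b\<in>B. \<Sum>c\<in>C. f a b c) = (\<Sum>a\<in>A. \<Sum>c\<in>C. \<Sum>b\<in>B. f a b c)"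
    by (intro sum.cong refl sum.swap)
  then show ?thesis by (simp only: sum.swap[of _ C A])
qed

definition contraction :: "'n::finite \<Rightarrow> 'n \<Rightarrow> ('n conf \<Rightarrow> real) \<Rightarrow> 'n conf \<Rightarrow> real" where
  "contraction I J F x = (\<Sum>i\<in>UNIV. partial I i (partial J i F) x)"

definition quad :: "('n \<Rightarrow> 'n \<Rightarrow> 'n conf \<Rightarrow> real) \<Rightarrow> 'n::finite conf \<Rightarrow> real" where
  "quad U x = 2 * (\<Sum>I\<in>UNIV. \<Sum>J\<in>UNIV. U I J x * (x $ I \<bullet> x $ J))"

lemma smooth_on_contraction: "open S \<Longrightarrow> smooth_on S F \<Longrightarrow> smooth_on S (contraction I J F)"
  unfolding contraction_def by (intro smooth_on_sum smooth_on_partial)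

lemma smooth_on_quad:
  assumes "open S" "\<And>I J. smooth_on S (U I J)"
  shows "smooth_on S (quad U)"
  unfolding quad_def inner_vec_def inner_real_def
  by (intro smooth_on_mult smooth_on_sum smooth_on_const smooth_on_coord assms)

lemma frechet_derivative_axis:
  assumes "F differentiable (at x)"
  shows "frechet_derivative F (at x) (axis J r) = (\<Sum>j\<in>UNIV. r $ j * partial J j F x)"
proof -
  have "frechet_derivative F (at x) (axis J r) =
      (\<Sum>I\<in>UNIV. if I = J then (\<Sum>j\<in>UNIV. r $ j * partial J j F x) else 0)"
    unfolding frechet_derivative_partials[OF assms] by (intro sum.cong refl) (auto simp: axis_def)
  then show ?thesis by simp
qed

text \<open>The action rotates coordinate axes within each slot \<open>I\<close>, \<open>J\<close>,
  so second derivatives along arbitrary vectors of these slots are needed.\<close>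

lemma second_derivative_axis:
  assumes "open S" "smooth_on S F" "x \<in> S"
  shows "frechet_derivative (\<lambda>y. frechet_derivative F (at y) (axis J r)) (at x) (axis I s) =
    (\<Sum>k\<in>UNIV. \<Sum>j\<in>UNIV. s $ k * r $ j * partial I k (partial J j F) x)"
proof -
  have d: "partial J j F differentiable (at x)" for j
    by (rule smooth_on_differentiable[OF smooth_on_partial[OF assms(2)] assms(3)])
  have "frechet_derivative (\<lambda>y. frechet_derivative F (at y) (axis J r)) (at x) =
      frechet_derivative (\<lambda>y. \<Sum>j\<in>UNIV. r $ j * partial J j F y) (at x)"
    using frechet_derivative_axis smooth_on_differentiable[OF assms(2)]
    by (intro frechet_derivative_cong_open[OF assms(1,3)]) blast
  moreover have "(\<lambda>y. \<Sum>j\<in>UNIV. r $ j * partial J j F y) differentiable (at x)"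
    using d by (intro differentiable_sum ballI differentiable_mult) auto
  ultimately show ?thesis
    using d by (simp add: frechet_derivative_axis partial_sum partial_cmult sum_distrib_left mult.assoc)
qed

lemma equivariantD:
  "equivariant w S F \<Longrightarrow> x \<in> S \<Longrightarrow> q \<noteq> 0 \<Longrightarrow> F (act q x) = norm q powr (2 * w) * F x"
  unfolding equivariant_def by blast

section \<open>Contractions and quadratic forms of equivariant functions\<close>

context invariant_domain
begin

lemma derivative_act:
  assumes "\<And>y. y \<in> D \<Longrightarrow> F (act q y) = G y" "\<And>y. y \<in> D \<Longrightarrow> F differentiable (at y)"
    "q \<noteq> 0" "x \<in> D"
  shows "frechet_derivative F (at (act q x)) (act q v) = frechet_derivative G (at x) v"
proof -
  have "(F has_derivative frechet_derivative F (at (act q x))) (at (act q x))"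
    using assms(2)[OF act_D[OF assms(4,3)]] by (simp add: frechet_derivative_works)
  moreover have "(act q has_derivative act q) (at x)"
    using linear_act linear_conv_bounded_linear bounded_linear_imp_has_derivative by blast
  ultimately have "((\<lambda>y. F (act q y)) has_derivative
      (\<lambda>v. frechet_derivative F (at (act q x)) (act q v))) (at x)"
    using has_derivative_compose[of "act q" "act q" x UNIV F] by blast
  then have "(G has_derivative (\<lambda>v. frechet_derivative F (at (act q x)) (act q v))) (at x)"
    by (rule has_derivative_transform_within_open[OF _ open_D assms(4)]) (rule assms(1))
  then show ?thesis by (metis frechet_derivative_at)
qed

text \<open>Differentiating the equivariance law twice yields second derivatives along rotated axes.
  By \<open>rot_dual\<close> their contraction is the original one times \<open>norm q ^ 4\<close>,
  which lowers the weight by 2.\<close>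

lemma equivariant_contraction:
  assumes F: "smooth_on D F" and w: "equivariant w D F"
  shows "equivariant (w - 2) D (contraction I J F)"
  unfolding equivariant_def
proof (intro ballI allI impI)
  fix x and q :: quat assume x: "x \<in> D" and q: "q \<noteq> 0"
  let ?c = "norm q powr (2 * w)"
  have d: "F differentiable (at y)" if "y \<in> D" for y
    using F that by (rule smooth_on_differentiable)
  have dv: "(\<lambda>y. frechet_derivative F (at y) v) differentiable (at y)" if "y \<in> D" for v y
    by (rule smooth_on_differentiable[OF smooth_on_frechet_derivative[OF F] that])
  have cm: "frechet_derivative (\<lambda>y. ?c * G y) (at y) v = ?c * frechet_derivative G (at y) v"
    if "G differentiable (at y)" for G :: "'n conf \<Rightarrow> real" and y v
    using frechet_derivative_mult_at[of "\<lambda>y. ?c" y G v] that by simp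
  have 1: "frechet_derivative F (at (act q y)) (act q v) = ?c * frechet_derivative F (at y) v"
    if "y \<in> D" for y v
    using derivative_act[of F q "\<lambda>y. ?c * F y" y v] equivariantD[OF w _ q] q that d cm[OF d[OF that]]
    by simp
  \<comment> \<open>By \<open>1\<close>, the derivative in the fixed direction
    \<open>act q v\<close> again satisfies a transformation law under \<open>act q\<close>, so
    \<open>derivative_act\<close> applies a second time.\<close>
  have 2: "frechet_derivative (\<lambda>y. frechet_derivative F (at y) (act q v)) (at (act q x)) (act q u) =
      ?c * frechet_derivative (\<lambda>y. frechet_derivative F (at y) v) (at x) u" for u v
    using derivative_act[of "\<lambda>y. frechet_derivative F (at y) (act q v)" q
        "\<lambda>y. ?c * frechet_derivative F (at y) v" x u] 1 q x dv cm[OF dv[OF x]]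
    by simp
  let ?P = "\<lambda>k j. partial I k (partial J j F) (act q x)"
  let ?r = "\<lambda>i. rot q (axis i 1)"
  have "?c * contraction I J F x = (\<Sum>i\<in>UNIV. \<Sum>k\<in>UNIV. \<Sum>j\<in>UNIV. ?r i $ k * ?r i $ j * ?P k j)"
    unfolding contraction_def sum_distrib_left
  proof (intro sum.cong refl)
    fix i :: 3
    have "partial I i (partial J i F) x = frechet_derivative
        (\<lambda>y. frechet_derivative F (at y) (axis J (axis i 1))) (at x) (axis I (axis i 1))"
      by (simp add: partial_def[abs_def])
    then show "?c * partial I i (partial J i F) x = (\<Sum>k\<in>UNIV. \<Sum>j\<in>UNIV. ?r i $ k * ?r i $ j * ?P k j)"
      using 2[of "axis J (axis i 1)" "axis I (axis i 1)"]
        second_derivative_axis[OF open_D F act_D[OF x q]]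
      by (simp only: act_axis)
  qed
  also have "\<dots> = (\<Sum>k\<in>UNIV. \<Sum>i\<in>UNIV. \<Sum>j\<in>UNIV. ?r i $ k * ?r i $ j * ?P k j)"
    by (rule sum.swap)
  also have "\<dots> = (\<Sum>k\<in>UNIV. \<Sum>j\<in>UNIV. (\<Sum>i\<in>UNIV. ?r i $ k * ?r i $ j) * ?P k j)"
    unfolding sum_distrib_right by (intro sum.cong refl sum.swap)
  also have "\<dots> = (\<Sum>k\<in>UNIV. \<Sum>j\<in>UNIV. if k = j then norm q ^ 4 * ?P k j else 0)"
    unfolding rot_dual by (intro sum.cong refl) auto
  also have "\<dots> = norm q ^ 4 * contraction I J F (act q x)"
    by (simp add: contraction_def sum_distrib_left)
  finally have "norm q ^ 4 * contraction I J F (act q x) = ?c * contraction I J F x" by simp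
  moreover have "norm q powr (2 * (w - 2)) = ?c / norm q ^ 4"
    using q by (simp add: right_diff_distrib powr_diff powr_numeral)
  moreover have "norm q ^ 4 \<noteq> 0" using q by simp
  ultimately show "contraction I J F (act q x) = norm q powr (2 * (w - 2)) * contraction I J F x"
    by (metis nonzero_mult_div_cancel_left times_divide_eq_left)
qed

lemma contraction_commute:
  assumes "smooth_on D F" "x \<in> D"
  shows "contraction I J F x = contraction J I F x"
  unfolding contraction_def by (intro sum.cong refl partial_commute[OF open_D assms(2,1)])

text \<open>The constraint of (Ia) is the total symmetry of the third derivatives, up to the
  constraint of (Ib).\<close>

lemma partial_contraction:
  assumes F: "smooth_on D F" and x: "x \<in> D"
    and curl: "\<And>I J j k y. y \<in> D \<Longrightarrow> partial I j (partial J k F) y = partial I k (partial J j F) y"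
  shows "partial L l (contraction K J F) x = partial J l (contraction K L F) x"
proof -
  note S = smooth_on_partial
  \<comment> \<open>The derivative in slot \<open>K\<close> is moved outermost, so that the two
    remaining derivatives can be exchanged as functions on \<open>D\<close>.\<close>
  have e: "partial L l (contraction K J F) x = (\<Sum>i\<in>UNIV. partial K i (partial L l (partial J i F)) x)"
    for L l J
  proof -
    have "partial L l (contraction K J F) x = (\<Sum>i\<in>UNIV. partial L l (partial K i (partial J i F)) x)"
      unfolding contraction_def[abs_def]
      by (rule partial_sum) (auto intro: smooth_on_differentiable[OF _ x] S F)
    also have "\<dots> = (\<Sum>i\<in>UNIV. partial K i (partial L l (partial J i F)) x)"
      by (intro sum.cong refl partial_commute[OF open_D x] S F)
    finally show ?thesis .
  qed
  \<comment> \<open>The curl condition exchanges the components \<open>l\<close> and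
    \<open>i\<close>, commutation exchanges the whole derivatives; together they exchange the slots
    \<open>L\<close> and \<open>J\<close> only.\<close>
  have "partial L l (partial J i F) y = partial J l (partial L i F) y" if "y \<in> D" for i y
    using curl[OF that, of L l J i] partial_commute[OF open_D that F] by simp
  then show ?thesis
    unfolding e by (intro sum.cong refl partial_cong_open[OF open_D x])
qed

text \<open>The differentiated rotation identity relates \<open>T j i i\<close> to
  \<open>T i j i\<close>, whose sum over \<open>i\<close> vanishes by the differentiated Euler
  identity of weight 1. The Kronecker terms leave the factor 3 - 1 = 2.\<close>

lemma contraction_coord:
  assumes F: "smooth_on D F" and w: "equivariant 1 D F" and x: "x \<in> D"
    and curl: "\<And>I J j k y. y \<in> D \<Longrightarrow> partial I j (partial J k F) y = partial I k (partial J j F) y"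
  shows "(\<Sum>I\<in>UNIV. x $ I $ j * contraction J I F x) = 2 * partial J j F x"
proof -
  have d: "F differentiable (at y)" if "y \<in> D" for y
    using F that by (rule smooth_on_differentiable)
  have dp: "partial I i F differentiable (at x)" for I i
    using smooth_on_partial[OF F] x by (rule smooth_on_differentiable)
  \<comment> \<open>\<open>T j l k\<close> is what remains of the derivative of a contracted
    first-order identity after the explicit coordinate has been differentiated; the curl condition
    makes it symmetric in \<open>l\<close> and \<open>k\<close>.\<close>
  define T where "T j l k = (\<Sum>I\<in>UNIV. x $ I $ j * partial J l (partial I k F) x)" for j l k
  have T_sym: "T j l k = T j k l" for j l k
    unfolding T_def by (intro sum.cong refl arg_cong2[of _ _ _ _ "(*)"] curl[OF x])
  have dT: "partial J l (\<lambda>y. \<Sum>I\<in>UNIV. y $ I $ j * partial I k F y) x =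
      (if l = j then partial J k F x else 0) + T j l k" for j k l
    unfolding T_def by (rule partial_sum_coord_mult[OF dp])
  have T_rot: "(if l = j then partial J k F x else 0) + T j l k =
      (if l = k then partial J j F x else 0) + T k l j" for j k l
    unfolding dT[symmetric]
    by (intro partial_cong_open[OF open_D x] rotation_invariance[OF w d]) auto
  have "partial J l (\<lambda>y. \<Sum>i\<in>UNIV. \<Sum>I\<in>UNIV. y $ I $ i * partial I i F y) x = partial J l F x" for l
  proof (intro partial_cong_open[OF open_D x])
    fix y assume "y \<in> D"
    then show "(\<Sum>i\<in>UNIV. \<Sum>I\<in>UNIV. y $ I $ i * partial I i F y) = F y"
      using euler[OF w d] by (subst sum.swap) simp
  qed
  moreover have "partial J l (\<lambda>y. \<Sum>i\<in>UNIV. \<Sum>I\<in>UNIV. y $ I $ i * partial I i F y) x =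
      (\<Sum>i\<in>UNIV. (if l = i then partial J i F x else 0) + T i l i)" for l
    by (subst partial_sum) (auto simp: dT dp coord_differentiable intro!: sum.cong)
  ultimately have T_euler: "(\<Sum>i\<in>UNIV. T i l i) = 0" for l
    by (simp add: sum.distrib)
  have "(\<Sum>i\<in>UNIV. (if i = j then partial J i F x else 0) + T j i i) =
      (\<Sum>i\<in>UNIV. partial J j F x + T i j i)"
    using T_rot[of _ j] T_sym[of _ _ j] by (intro sum.cong refl) fastforce
  then have "(\<Sum>i\<in>UNIV. T j i i) = 2 * partial J j F x"
    by (simp add: sum.distrib T_euler)
  moreover have "(\<Sum>i\<in>UNIV. T j i i) = (\<Sum>I\<in>UNIV. x $ I $ j * contraction J I F x)"
    unfolding T_def contraction_def sum_distrib_left by (rule sum.swap)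
  ultimately show ?thesis by simp
qed

text \<open>Pulling out one coordinate factor leaves the sum of \<open>contraction_coord\<close>;
  the other factor then forms the Euler operator. The constants 2, 1/4 and 2 multiply to 1.\<close>

lemma quad_contraction:
  assumes F: "smooth_on D F" and w: "equivariant 1 D F" and x: "x \<in> D"
    and curl: "\<And>I J j k y. y \<in> D \<Longrightarrow> partial I j (partial J k F) y = partial I k (partial J j F) y"
  shows "quad (\<lambda>I J x. 1/4 * contraction I J F x) x = F x"
proof -
  have "(\<Sum>J\<in>UNIV. \<Sum>I\<in>UNIV. contraction J I F x * (x $ J \<bullet> x $ I)) =
      (\<Sum>J\<in>UNIV. \<Sum>j\<in>UNIV. x $ J $ j * (\<Sum>I\<in>UNIV. x $ I $ j * contraction J I F x))"
    unfolding inner_vec_def inner_real_def sum_distrib_left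
    by (intro sum.cong refl, subst sum.swap) (simp add: mult_ac)
  also have "\<dots> = 2 * (\<Sum>J\<in>UNIV. \<Sum>j\<in>UNIV. x $ J $ j * partial J j F x)"
    by (simp add: contraction_coord[OF F w x curl] sum_distrib_left mult_ac)
  also have "\<dots> = 2 * F x"
    using euler[OF w smooth_on_differentiable[OF F x] x] by simp
  finally show ?thesis unfolding quad_def by (simp add: sum_divide_distrib[symmetric])
qed

text \<open>The coefficients scale by \<open>norm q\<close> to the power -2 and the inner products
  by \<open>norm q ^ 4\<close>, leaving \<open>norm q ^ 2\<close>, that is, weight 1.\<close>

lemma equivariant_quad:
  assumes "\<And>I J. equivariant (-1) D (U I J)"
  shows "equivariant 1 D (quad U)"
  unfolding equivariant_def
proof (intro ballI allI impI)
  fix x and q :: quat assume x: "x \<in> D" and q: "q \<noteq> 0"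
  have "norm q powr - 2 * norm q ^ 4 = norm q ^ 2"
    using q by (simp add: powr_minus powr_numeral field_simps power4_eq_xxxx power2_eq_square)
  then have "quad U (act q x) = norm q ^ 2 * quad U x"
    using equivariantD[OF assms x q]
    by (simp add: quad_def act_nth rot_inner sum_distrib_left mult_ac)
  then show "quad U (act q x) = norm q powr (2 * 1) * quad U x"
    using q by (simp add: powr_numeral)
qed

end

section \<open>The data (Ia) as functions on the preimage, and their potential\<close>

locale potential_matrix = invariant_domain D for D :: "'n::finite conf set" +
  fixes U :: "'n \<Rightarrow> 'n \<Rightarrow> 'n conf \<Rightarrow> real"
  assumes smooth_U: "smooth_on D (U I J)"
    and equivariant_U: "equivariant (-1) D (U I J)"
    and sym_U: "U I J = U J I"
    and closed_U: "x \<in> D \<Longrightarrow> partial I i (U K J) x = partial J i (U K I) x"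
begin

lemma differentiable_U: "x \<in> D \<Longrightarrow> U I J differentiable (at x)"
  using smooth_U by (rule smooth_on_differentiable)

text \<open>Write \<open>G\<close> for the sum on the right. Differentiating the two explicit
  coordinates gives \<open>G\<close> twice; the derivatives of \<open>U\<close> can be rearranged
  into the Euler operator, whose weight -1 removes one \<open>G\<close> again.\<close>

lemma partial_quad:
  assumes x: "x \<in> D"
  shows "partial K k (quad U) x = 2 * (\<Sum>J\<in>UNIV. x $ J $ k * U K J x)"
proof -
  \<comment> \<open>Splitting the quadratic form into two nested linear ones makes
    \<open>partial_sum_coord_mult\<close> applicable twice.\<close>
  define G where "G m I x = (\<Sum>J\<in>UNIV. x $ J $ m * U I J x)" for m I and x :: "'n conf"
  note d = differentiable_U[OF x]
  have dG: "G m I differentiable (at x)" for m I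
    unfolding G_def by (intro differentiable_sum ballI differentiable_mult coord_differentiable d) simp
  have pG: "partial K k (G m I) x =
      (if k = m then U I K x else 0) + (\<Sum>J\<in>UNIV. x $ J $ m * partial K k (U I J) x)" for m I
    unfolding G_def by (rule partial_sum_coord_mult[OF d])
  have quad: "quad U = (\<lambda>x. 2 * (\<Sum>m\<in>UNIV. \<Sum>I\<in>UNIV. x $ I $ m * G m I x))"
  proof
    fix x
    show "quad U x = 2 * (\<Sum>m\<in>UNIV. \<Sum>I\<in>UNIV. x $ I $ m * G m I x)"
      unfolding quad_def G_def inner_vec_def inner_real_def sum_distrib_left
      by (subst sum_rotate) (simp add: mult_ac)
  qed
  have dS: "(\<lambda>x. \<Sum>I\<in>UNIV. x $ I $ m * G m I x) differentiable (at x)" for m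
    by (intro differentiable_sum ballI differentiable_mult coord_differentiable dG finite)
  have "partial K k (quad U) x = 2 * (\<Sum>m\<in>UNIV. partial K k (\<lambda>x. \<Sum>I\<in>UNIV. x $ I $ m * G m I x) x)"
    unfolding quad using dS by (simp add: partial_cmult partial_sum)
  also have "\<dots> = 2 * (\<Sum>m\<in>UNIV. (if k = m then G m K x else 0) +
      (\<Sum>I\<in>UNIV. x $ I $ m * partial K k (G m I) x))"
    by (simp only: partial_sum_coord_mult[OF dG])
  also have "\<dots> = 2 * (G k K x + (\<Sum>m\<in>UNIV. \<Sum>I\<in>UNIV. x $ I $ m * partial K k (G m I) x))"
    by (simp add: sum.distrib)
  also have "(\<Sum>m\<in>UNIV. \<Sum>I\<in>UNIV. x $ I $ m * partial K k (G m I) x) =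
      (\<Sum>m\<in>UNIV. \<Sum>I\<in>UNIV. if k = m then x $ I $ m * U I K x else 0) +
      (\<Sum>m\<in>UNIV. \<Sum>I\<in>UNIV. x $ I $ m * (\<Sum>J\<in>UNIV. x $ J $ m * partial K k (U I J) x))"
    unfolding pG sum.distrib[symmetric] by (intro sum.cong refl) (simp add: distrib_left)
  also have "(\<Sum>m\<in>UNIV. \<Sum>I\<in>UNIV. if k = m then x $ I $ m * U I K x else 0) = G k K x"
    unfolding G_def by (subst sum.swap) (simp add: sym_U[of K])
  \<comment> \<open>The slot \<open>K\<close> of the derivative is traded for the summed
    \<open>J\<close>, so that the rotation identity can exchange the components \<open>k\<close> and
    \<open>m\<close> in the next step.\<close>
  also have "(\<Sum>m\<in>UNIV. \<Sum>I\<in>UNIV. x $ I $ m * (\<Sum>J\<in>UNIV. x $ J $ m * partial K k (U I J) x)) =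
      (\<Sum>m\<in>UNIV. \<Sum>I\<in>UNIV. x $ I $ m * (\<Sum>J\<in>UNIV. x $ J $ m * partial J k (U I K) x))"
    by (simp add: closed_U[OF x, of K])
  also have "\<dots> = (\<Sum>m\<in>UNIV. \<Sum>I\<in>UNIV. x $ I $ m * (\<Sum>J\<in>UNIV. x $ J $ k * partial J m (U I K) x))"
    by (simp only: rotation_invariance[OF equivariant_U d x, where k = k])
  \<comment> \<open>Symmetry and closedness now trade \<open>J\<close> for \<open>I\<close>: the
    derivative is paired with the coordinate of the same slot and component, which is the Euler
    operator.\<close>
  also have "\<dots> = (\<Sum>m\<in>UNIV. \<Sum>I\<in>UNIV. x $ I $ m * (\<Sum>J\<in>UNIV. x $ J $ k * partial I m (U K J) x))"
    by (simp only: sym_U[of _ K] closed_U[OF x, of _ _ K])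
  also have "\<dots> = (\<Sum>J\<in>UNIV. x $ J $ k * (\<Sum>I\<in>UNIV. \<Sum>m\<in>UNIV. x $ I $ m * partial I m (U K J) x))"
    unfolding sum_distrib_left
    by (subst sum_rotate, intro sum.cong refl, subst sum.swap) (simp add: mult_ac)
  also have "\<dots> = - G k K x"
    unfolding euler[OF equivariant_U d x] G_def by (simp add: sum_negf)
  finally show ?thesis by (simp add: G_def)
qed

text \<open>Closedness, used after the second differentiation, puts the summed slot on the
  derivative; the rotation identity then gives symmetry in \<open>l\<close> and \<open>k\<close>,
  and the Euler identity gives the trace.\<close>

lemma partial_partial_quad:
  assumes x: "x \<in> D"
  shows "partial L l (partial K k (quad U)) x =
    2 * ((if l = k then U K L x else 0) + (\<Sum>J\<in>UNIV. x $ J $ k * partial J l (U K L) x))"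
proof -
  have "partial L l (partial K k (quad U)) x = partial L l (\<lambda>x. 2 * (\<Sum>J\<in>UNIV. x $ J $ k * U K J x)) x"
    by (rule partial_cong_open[OF open_D x partial_quad])
  also have "\<dots> = 2 * partial L l (\<lambda>x. \<Sum>J\<in>UNIV. x $ J $ k * U K J x) x"
    by (intro partial_cmult differentiable_sum ballI differentiable_mult coord_differentiable
        differentiable_U x finite)
  also have "\<dots> = 2 * ((if l = k then U K L x else 0) + (\<Sum>J\<in>UNIV. x $ J $ k * partial L l (U K J) x))"
    by (subst partial_sum_coord_mult) (simp_all add: differentiable_U x)
  finally show ?thesis by (simp only: closed_U[OF x, of L])
qed

lemma curl_quad:
  assumes x: "x \<in> D"
  shows "partial L l (partial K k (quad U)) x = partial L k (partial K l (quad U)) x"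
  unfolding partial_partial_quad[OF x] rotation_invariance[OF equivariant_U differentiable_U[OF x] x, where j = k and k = l]
  by simp

text \<open>The Kronecker term is counted once for each of the three dimensions, and the Euler
  identity of weight -1 takes one copy away: 2 (3 - 1) = 4.\<close>

lemma contraction_quad:
  assumes x: "x \<in> D"
  shows "contraction L K (quad U) x = 4 * U L K x"
proof -
  have "(\<Sum>i\<in>UNIV. \<Sum>J\<in>UNIV. x $ J $ i * partial J i (U K L) x) = - U K L x"
    using euler[OF equivariant_U differentiable_U[OF x] x, of K L] by (subst sum.swap) simp
  then show ?thesis
    unfolding contraction_def partial_partial_quad[OF x]
    by (simp add: sum.distrib sum_distrib_left[symmetric] sym_U[of L])
qed

end

section \<open>Slices\<close>

text \<open>Fixing the nonzero vector \<open>a\<close> forces norm 1, so \<open>rot q\<close>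
  preserves inner and cross products and fixes the frame \<open>a\<close>, \<open>v\<close>,
  \<open>cross3 a v\<close>. Then \<open>rot q z - z\<close> is orthogonal to this frame.\<close>

lemma frame_stabilizer:
  assumes a: "rot q a = a" and v: "rot q v = v" and n: "cross3 a v \<noteq> 0"
  shows "rot q z = z"
proof -
  have "a \<noteq> 0" using n by auto
  then have q: "norm q ^ 2 = 1" using rot_norm[of q a] a by simp
  then have q4: "norm q ^ 4 = 1" using power_mult[of "norm q" 2 2] by simp
  have c: "rot q (cross3 a v) = cross3 a v" using rot_cross[of q a v] a v q by simp
  define f where "f = rot q z - z"
  have "f \<bullet> w = 0" if "rot q w = w" for w
    using rot_inner[of q z w] that q4 by (simp add: f_def inner_diff_left)
  then have "f \<bullet> a = 0" "f \<bullet> v = 0" "f \<bullet> cross3 a v = 0" using a v c by auto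
  then have "f \<bullet> cross3 a v = 0 \<and> cross3 f (cross3 a v) = 0" by (simp add: Lagrange)
  then show ?thesis using n by (simp only: norm_and_cross_eq_0) (simp add: f_def)
qed

text \<open>The difference \<open>e\<close> is parallel to \<open>cross3 c a\<close>, being
  orthogonal to \<open>a\<close> and \<open>c\<close>, and orthogonal to the sum \<open>w\<close>
  because the lengths agree. As \<open>w\<close> has a positive component along
  \<open>cross3 c a\<close>, \<open>e\<close> vanishes.\<close>

lemma half_plane_point_unique:
  assumes a: "v' \<bullet> a = v \<bullet> a" and c: "v \<bullet> c = 0" "v' \<bullet> c = 0" and n: "v' \<bullet> v' = v \<bullet> v"
    and pos: "v \<bullet> cross3 c a > 0" "v' \<bullet> cross3 c a > 0"
  shows "v' = v"
proof -
  define e where "e = v' - v"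
  define w where "w = v + v'"
  have "e \<bullet> a = 0" "e \<bullet> c = 0" using a c by (simp_all add: e_def inner_diff_left)
  then have "cross3 e (cross3 c a) = 0" by (simp add: Lagrange)
  then have "cross3 w (cross3 e (cross3 c a)) = 0" by simp
  moreover have "w \<bullet> e = 0"
    using n by (simp add: e_def w_def inner_diff_right inner_add_left inner_commute[of v' v])
  ultimately have "(w \<bullet> cross3 c a) *\<^sub>R e = 0" by (simp only: Lagrange[of w e]) simp
  moreover have "w \<bullet> cross3 c a > 0" using pos by (simp add: w_def inner_add_left)
  ultimately show ?thesis by (simp add: e_def)
qed

text \<open>Pairing the second equation with \<open>a\<close> removes the scaling; then \<beta> is
  parallel to \<open>a\<close>, and the first equation becomes a multiple of
  \<open>v \<bullet> cross3 c a\<close>.\<close>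

lemma orbit_tangent_transversal:
  assumes "a \<noteq> 0" "v \<bullet> cross3 c a \<noteq> 0"
    and "(\<alpha> *\<^sub>R v - cross3 \<beta> v) \<bullet> c = 0" "\<alpha> *\<^sub>R a - cross3 \<beta> a = 0"
  shows "\<alpha> = 0" "\<beta> = 0"
proof -
  have "(\<alpha> *\<^sub>R a - cross3 \<beta> a) \<bullet> a = 0" using assms(4) by simp
  then show \<alpha>: "\<alpha> = 0" using assms(1) by (simp add: inner_diff_left dot_cross_self)
  then have "cross3 a (cross3 \<beta> a) = 0" using assms(4) by simp
  then have \<beta>: "(a \<bullet> a) *\<^sub>R \<beta> = (a \<bullet> \<beta>) *\<^sub>R a" by (simp add: Lagrange)
  have "v \<bullet> cross3 c \<beta> = cross3 \<beta> v \<bullet> c"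
    by (simp add: inner_vec_def sum_3 cross_components algebra_simps)
  then have "v \<bullet> cross3 c ((a \<bullet> a) *\<^sub>R \<beta>) = 0"
    using assms(3) \<alpha> by (simp add: cross_mult_right inner_diff_left)
  then have "(a \<bullet> \<beta>) * (v \<bullet> cross3 c a) = 0" unfolding \<beta> by (simp add: cross_mult_right)
  then show "\<beta> = 0" using \<beta> assms(1,2) by simp
qed

lemma linear_orbit_tangent: "linear (orbit_tangent x)"
proof (rule linearI)
  show "orbit_tangent x (g + h) = orbit_tangent x g + orbit_tangent x h" for g h
    by (subst vec_eq_iff)
      (simp add: orbit_tangent_def case_prod_unfold cross_add_left algebra_simps)
  show "orbit_tangent x (r *\<^sub>R g) = r *\<^sub>R orbit_tangent x g" for r g
    by (subst vec_eq_iff)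
      (simp add: orbit_tangent_def case_prod_unfold cross_mult_left algebra_simps)
qed

text \<open>Fix the vector \<open>x\<^sup>A\<close> and a half plane bounded by its line for the vector \<open>x\<^sup>B\<close>.\<close>

lemma slice_exists:
  fixes S :: "'n::finite conf set set"
  assumes "open (\<Union>S)" "x \<in> \<Union>S" "x \<notin> C_deg"
  shows "\<exists>\<Sigma>. slice S \<Sigma> \<and> x \<in> \<Sigma>"
proof -
  obtain A B where AB: "cross3 (x $ A) (x $ B) \<noteq> 0" using assms(3) by (auto simp: C_deg_iff)
  \<comment> \<open>\<open>c\<close> is normal to the plane of the two vectors; \<open>d\<close>
    lies in that plane, is orthogonal to \<open>a\<close> and points to the side of
    \<open>x $ B\<close>, so it selects the half plane.\<close>
  define a c d where "a = x $ A" and "c = cross3 a (x $ B)" and "d = cross3 c a"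
  have a0: "a \<noteq> 0" using AB by (auto simp: a_def)
  have "x $ B \<bullet> d = c \<bullet> c"
    by (simp add: c_def d_def inner_vec_def sum_3 cross_components algebra_simps)
  then have xd: "x $ B \<bullet> d > 0" using AB by (simp add: c_def a_def)
  define W where "W = \<Union>S \<inter> {y. y $ B \<bullet> d > 0}"
  \<comment> \<open>The four equations of the slice: one keeps the vector in slot \<open>B\<close>
    in the plane normal to \<open>c\<close>, three fix the vector in slot \<open>A\<close>.\<close>
  define L where "L = (\<lambda>y :: 'n conf. (y $ B \<bullet> c, y $ A))"
  define \<phi> where "\<phi> = (\<lambda>y. L y + (0, - a))"
  define \<Sigma> where "\<Sigma> = {y \<in> W. \<phi> y = 0}"
  have L: "bounded_linear L"
    unfolding L_def
    by (intro bounded_linear_Pair bounded_linear_vec_nth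
        bounded_linear_compose[OF bounded_linear_inner_left bounded_linear_vec_nth])
  have W: "open W"
    unfolding W_def by (intro open_Int assms(1) open_Collect_less continuous_intros)
  have \<Sigma>_iff: "y \<in> \<Sigma> \<longleftrightarrow> y \<in> \<Union>S \<and> y $ B \<bullet> d > 0 \<and> y $ B \<bullet> c = 0 \<and> y $ A = a" for y
    by (auto simp: \<Sigma>_def W_def \<phi>_def L_def zero_prod_def)
  have x: "x \<in> \<Sigma>" using assms(2) xd by (simp add: \<Sigma>_iff a_def c_def dot_cross_self)
  have "\<Sigma> \<inter> orbit y = {y}" if y: "y \<in> \<Sigma>" for y
  proof (intro equalityI subsetI)
    fix z assume "z \<in> \<Sigma> \<inter> orbit y"
    then obtain q where z: "z \<in> \<Sigma>" "z = act q y" by (auto simp: orbit_def)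
    have qa: "rot q a = a" using y z by (simp add: \<Sigma>_iff act_nth)
    then have "norm q ^ 2 = 1" using a0 rot_norm[of q a] by simp
    then have "norm q ^ 4 = 1" using power_mult[of "norm q" 2 2] by simp
    then have ip: "rot q u \<bullet> rot q w = u \<bullet> w" for u w by (simp add: rot_inner)
    have qv: "rot q (y $ B) = y $ B"
    proof (rule half_plane_point_unique)
      show "rot q (y $ B) \<bullet> a = y $ B \<bullet> a" using ip[of "y $ B" a] qa by simp
    qed (use y z ip in \<open>auto simp: \<Sigma>_iff act_nth d_def\<close>)
    have "y $ B \<bullet> d = c \<bullet> cross3 a (y $ B)"
      by (simp add: d_def inner_vec_def sum_3 cross_components algebra_simps)
    then have "cross3 a (y $ B) \<noteq> 0" using y by (auto simp: \<Sigma>_iff)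
    then have "act q y = y" by (simp add: vec_eq_iff[of "act q y"] act_nth frame_stabilizer[OF qa qv])
    then show "z \<in> {y}" using z by simp
  qed (use y orbit_self in auto)
  moreover have "bij (\<lambda>g. frechet_derivative \<phi> (at y) (orbit_tangent y g))" if y: "y \<in> \<Sigma>" for y
  proof -
    have "(\<phi> has_derivative L) (at y)"
      unfolding \<phi>_def by (rule has_derivative_add_const[OF bounded_linear_imp_has_derivative[OF L]])
    then have D: "frechet_derivative \<phi> (at y) = L" by (metis frechet_derivative_at)
    have lin: "linear (\<lambda>g. L (orbit_tangent y g))"
      using linear_compose[OF linear_orbit_tangent bounded_linear.linear[OF L]] by (simp add: o_def)
    have "g = 0" if "L (orbit_tangent y g) = 0" for g
    proof (cases g)
      case (Pair \<alpha> \<beta>)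
      have "(\<alpha> *\<^sub>R (y $ B) - cross3 \<beta> (y $ B)) \<bullet> c = 0" "\<alpha> *\<^sub>R a - cross3 \<beta> a = 0"
        using that y Pair by (auto simp: L_def orbit_tangent_def zero_prod_def \<Sigma>_iff)
      from orbit_tangent_transversal[OF a0 _ this] y Pair show ?thesis
        by (auto simp: \<Sigma>_iff d_def zero_prod_def)
    qed
    then have "inj (\<lambda>g. L (orbit_tangent y g))"
      using linear_injective_0[OF lin] by blast
    then show ?thesis
      unfolding D bij_def using linear_injective_imp_surjective[OF lin] by blast
  qed
  moreover have "smooth_on W \<phi>" unfolding \<phi>_def by (rule smooth_on_affine[OF L])
  moreover have "\<Sigma> \<inter> W = {y \<in> W. \<phi> y = 0}" "\<Sigma> \<subseteq> W" by (auto simp: \<Sigma>_def)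
  moreover have "\<Sigma> \<subseteq> \<Union>S" by (auto simp: \<Sigma>_iff)
  ultimately have "slice S \<Sigma>" unfolding slice_def using W by blast
  with x show ?thesis by blast
qed

section \<open>Preimages of open sets and pointwise constraints\<close>

lemma openin_ImHP_orbit:
  assumes "openin ImHP_topology S" "p \<in> S" "x \<in> p"
  shows "x \<notin> C_deg" "orbit x = p"
proof -
  have "p \<in> ImHP" using assms openin_ImHP by blast
  then obtain y where y: "y \<notin> C_deg" "p = orbit y" by (auto simp: ImHP_def)
  with assms(3) obtain q where "q \<noteq> 0" "x = act q y" by (auto simp: orbit_def)
  with y show "x \<notin> C_deg" "orbit x = p" by (simp_all add: act_nondeg orbit_act)
qed

lemma Union_ImHP:
  assumes "openin ImHP_topology S"
  shows "\<Union>S = {x \<in> - C_deg. orbit x \<in> S}"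
proof (intro equalityI subsetI)
  fix x assume "x \<in> \<Union>S"
  then obtain p where "p \<in> S" "x \<in> p" by blast
  then show "x \<in> {x \<in> - C_deg. orbit x \<in> S}"
    using openin_ImHP_orbit[OF assms, of p x] by simp
qed (use orbit_self in blast)

text \<open>Openness in the quotient is relative to the nondegenerate configurations, which are
  themselves open, so the derivatives at points of the preimage make sense.\<close>

lemma open_Union_ImHP:
  assumes "openin ImHP_topology S"
  shows "open (\<Union>S)"
  using assms openin_ImHP openin_open_eq[OF open_nondeg] unfolding Union_ImHP[OF assms] by blast

lemma invariant_domain_Union:
  assumes "openin ImHP_topology S"
  shows "invariant_domain (\<Union>S)"
proof
  show "open (\<Union>S)" by (rule open_Union_ImHP[OF assms])
next
  fix x and q :: quat assume "x \<in> \<Union>S" "q \<noteq> 0"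
  then show "act q x \<in> \<Union>S" unfolding Union_ImHP[OF assms] by (simp add: act_nondeg orbit_act)
qed

text \<open>Besides the constraints, this turns the formulas for the two maps, stated on slices,
  into identities on the whole preimage.\<close>

lemma ball_slices_iff:
  assumes "openin ImHP_topology S"
  shows "(\<forall>\<Sigma>. slice S \<Sigma> \<longrightarrow> (\<forall>\<rho>\<in>\<Sigma>. P \<rho>)) \<longleftrightarrow> (\<forall>\<rho>\<in>\<Union>S. P \<rho>)"
proof
  assume *: "\<forall>\<Sigma>. slice S \<Sigma> \<longrightarrow> (\<forall>\<rho>\<in>\<Sigma>. P \<rho>)"
  show "\<forall>\<rho>\<in>\<Union>S. P \<rho>"
  proof
    fix \<rho> assume "\<rho> \<in> \<Union>S"
    then show "P \<rho>"
      using * slice_exists[OF open_Union_ImHP[OF assms]] openin_ImHP_orbit(1)[OF assms] by blast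
  qed
qed (auto simp: slice_def)

section \<open>Sections as equivariant functions\<close>

lemma bundle_class_act:
  assumes "q \<noteq> 0"
  shows "bundle_class w (act q x) (norm q powr (2 * w) * v) = bundle_class w x v"
proof (intro equalityI subsetI)
  fix y assume "y \<in> bundle_class w (act q x) (norm q powr (2 * w) * v)"
  then obtain p where "p \<noteq> 0" "y = (act p (act q x), norm p powr (2 * w) * (norm q powr (2 * w) * v))"
    by (auto simp: bundle_class_def)
  then have "y = (act (quat_mult q p) x, norm (quat_mult q p) powr (2 * w) * v)" "quat_mult q p \<noteq> 0"
    using assms by (simp_all add: act_act norm_quat_mult powr_mult quat_mult_nonzero)
  then show "y \<in> bundle_class w x v" unfolding bundle_class_def by blast
next
  fix y assume "y \<in> bundle_class w x v"
  then obtain p where p: "p \<noteq> 0" "y = (act p x, norm p powr (2 * w) * v)"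
    by (auto simp: bundle_class_def)
  \<comment> \<open>\<open>r\<close> solves \<open>quat_mult q r = p\<close>, so that acting by
    \<open>q\<close> and then by \<open>r\<close> is acting by \<open>p\<close>.\<close>
  define r where "r = quat_mult (quat_inv q) p"
  have "act r (act q x) = act p x"
    using assms by (simp add: r_def act_act[symmetric] act_inv)
  moreover have "norm r * norm q = norm p"
    using quat_mult_inv[OF assms] norm_quat_mult[of q "quat_inv q"]
    by (simp add: r_def norm_quat_mult mult.commute)
  then have "norm r powr (2 * w) * norm q powr (2 * w) = norm p powr (2 * w)"
    by (metis powr_mult)
  ultimately have "y = (act r (act q x), norm r powr (2 * w) * (norm q powr (2 * w) * v))"
    using p by (simp flip: mult.assoc)
  moreover have "r \<noteq> 0" using assms p by (simp add: r_def quat_mult_nonzero quat_inv_nonzero)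
  ultimately show "y \<in> bundle_class w (act q x) (norm q powr (2 * w) * v)"
    unfolding bundle_class_def by blast
qed

lemma bundle_class_self: "(x, v) \<in> bundle_class w x v"
proof -
  have "(x, v) = (act (1, 0) x, norm (1 :: real, 0 :: real^3) powr (2 * w) * v)"
    "(1, 0) \<noteq> (0 :: quat)"
    by (simp_all add: act_one zero_prod_def)
  then show ?thesis unfolding bundle_class_def by blast
qed

text \<open>A nonzero vector of \<open>x\<close> determines the scaling, and the fibre coordinate
  depends on the quaternion only through its norm. Hence a bundle class has one value over each
  point.\<close>

lemma act_eq_imp_norm_eq:
  assumes "x \<notin> C_deg" "act p x = act q x"
  shows "norm p = norm q"
proof -
  obtain A where "x $ A \<noteq> 0" using assms(1) unfolding C_deg_iff by (metis cross_zero_left)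
  moreover have "norm p ^ 2 * norm (x $ A) = norm q ^ 2 * norm (x $ A)"
    using assms(2) by (simp only: rot_norm[symmetric] act_nth[symmetric])
  ultimately show ?thesis by (simp add: power2_eq_iff_nonneg)
qed

lemma bundle_class_unique:
  assumes "x \<notin> C_deg" "(y, a) \<in> bundle_class w x v" "(y, b) \<in> bundle_class w x v"
  shows "a = b"
proof -
  obtain p q where "y = act p x" "a = norm p powr (2 * w) * v" "y = act q x" "b = norm q powr (2 * w) * v"
    using assms(2,3) unfolding bundle_class_def by blast
  with act_eq_imp_norm_eq[OF assms(1), of p q] show ?thesis by simp
qed

text \<open>The fibre supplies a representative somewhere on the orbit;
  \<open>bundle_class_act\<close> moves it to \<open>x\<close>, and uniqueness justifies the
  definite description in \<open>rep\<close>.\<close>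

lemma section_eq_bundle_class:
  assumes S: "openin ImHP_topology S" and s: "s \<in> sections w S" and x: "x \<in> \<Union>S"
  shows "s (orbit x) = bundle_class w x (rep s x)"
proof -
  have xD: "x \<notin> C_deg" "orbit x \<in> S" using x unfolding Union_ImHP[OF S] by auto
  then have "s (orbit x) \<in> fibre w (orbit x)" using s by (simp add: sections_def)
  then obtain q v where q: "q \<noteq> 0" and e: "s (orbit x) = bundle_class w (act q x) v"
    by (auto simp: fibre_def orbit_def)
  have "v = norm q powr (2 * w) * (v / norm q powr (2 * w))" using q by simp
  then have e': "s (orbit x) = bundle_class w x (v / norm q powr (2 * w))"
    using e bundle_class_act[OF q] by metis
  then have "rep s x = v / norm q powr (2 * w)"
    unfolding rep_def e'
    by (intro the_equality bundle_class_self bundle_class_unique[OF xD(1) _ bundle_class_self])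
  with e' show ?thesis by simp
qed

lemma equivariant_rep:
  assumes S: "openin ImHP_topology S" and s: "s \<in> sections w S"
  shows "equivariant w (\<Union>S) (rep s)"
  unfolding equivariant_def
proof (intro ballI allI impI)
  fix x and q :: quat assume x: "x \<in> \<Union>S" and q: "q \<noteq> 0"
  have xD: "x \<notin> C_deg" using x unfolding Union_ImHP[OF S] by auto
  have "act q x \<in> \<Union>S" using invariant_domain.act_D[OF invariant_domain_Union[OF S] x q] .
  from section_eq_bundle_class[OF S s this] section_eq_bundle_class[OF S s x]
  have "bundle_class w (act q x) (rep s (act q x)) = bundle_class w x (rep s x)"
    by (simp add: orbit_act q)
  then have "(act q x, rep s (act q x)) \<in> bundle_class w x (rep s x)"
    using bundle_class_self by blast
  moreover have "(act q x, norm q powr (2 * w) * rep s x) \<in> bundle_class w x (rep s x)"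
    unfolding bundle_class_def using q by blast
  ultimately show "rep s (act q x) = norm q powr (2 * w) * rep s x"
    by (rule bundle_class_unique[OF xD])
qed

text \<open>The value at an orbit is the class determined by \<open>rep\<close>, and extensionality
  fixes the values outside \<open>S\<close>.\<close>

lemma section_eqI:
  assumes S: "openin ImHP_topology S" and "s \<in> sections w S" "t \<in> sections w S"
    and eq: "\<And>x. x \<in> \<Union>S \<Longrightarrow> rep s x = rep t x"
  shows "s = t"
proof (rule extensionalityI[where A = S])
  fix p assume p: "p \<in> S"
  then have "p \<in> ImHP" using S openin_ImHP by blast
  then obtain x where "p = orbit x" by (auto simp: ImHP_def)
  moreover from this p have "x \<in> \<Union>S" using orbit_self by blast
  ultimately show "s p = t p" using section_eq_bundle_class[OF S] assms by metis
qed (use assms in \<open>auto simp: sections_def\<close>)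

text \<open>The equivalence class of \<open>(x, F x)\<close> is the graph of \<open>F\<close> over the orbit of \<open>x\<close>.\<close>

definition section_of :: "'n::finite conf set set \<Rightarrow> ('n conf \<Rightarrow> real) \<Rightarrow> 'n field" where
  "section_of S F = (\<lambda>p\<in>S. (\<lambda>x. (x, F x)) ` p)"

lemma rep_section_of:
  assumes "openin ImHP_topology S" "x \<in> \<Union>S"
  shows "rep (section_of S F) x = F x"
proof -
  have "orbit x \<in> S" using assms unfolding Union_ImHP[OF assms(1)] by auto
  then show ?thesis
    unfolding rep_def section_of_def using orbit_self by (intro the_equality) auto
qed

lemma section_of_in_sections:
  assumes S: "openin ImHP_topology S" and F: "smooth_on (\<Union>S) F" and w: "equivariant w (\<Union>S) F"
  shows "section_of S F \<in> sections w S"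
proof -
  have "(\<lambda>x. (x, F x)) ` p \<in> fibre w p" if p: "p \<in> S" for p
  proof -
    have "p \<in> ImHP" using S p openin_ImHP by blast
    then obtain x where px: "p = orbit x" by (auto simp: ImHP_def)
    then have "x \<in> \<Union>S" using p orbit_self by blast
    then have "(\<lambda>x. (x, F x)) ` p = bundle_class w x (F x)"
      unfolding px orbit_def bundle_class_def using equivariantD[OF w] by fastforce
    then show ?thesis unfolding fibre_def px using orbit_self by blast
  qed
  moreover have "smooth_on (\<Union>S) (rep (section_of S F))"
    using smooth_on_cong[OF open_Union_ImHP[OF S] _ F] rep_section_of[OF S] by metis
  ultimately show ?thesis by (auto simp: sections_def section_of_def)
qed

text \<open>The three components are the antisymmetric parts of the second derivatives in
  \<open>j\<close> and \<open>k\<close>.\<close>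

lemma nabla_cross_eq_0_iff:
  "nabla_cross I J s \<rho> = 0 \<longleftrightarrow>
    (\<forall>j k. partial I j (partial J k (rep s)) \<rho> = partial I k (partial J j (rep s)) \<rho>)"
  by (simp add: nabla_cross_def nabla2_def vec_eq_iff forall_3 vector_3; argo)

lemma nabla_eq_iff: "nabla I s \<rho> = nabla J t \<rho> \<longleftrightarrow> (\<forall>i. partial I i (rep s) \<rho> = partial J i (rep t) \<rho>)"
  by (simp add: nabla_def vec_eq_iff)

lemma nabla_dot_eq_contraction: "nabla_dot I J s \<rho> = contraction I J (rep s) \<rho>"
  by (simp add: nabla_dot_def nabla2_def contraction_def)

text \<open>\<open>rep (section_of S F)\<close> is known to equal \<open>F\<close> only on the
  preimage of \<open>S\<close>; since that is open, the derivatives there agree.\<close>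

lemma partial_rep_section_of:
  assumes "openin ImHP_topology S" "x \<in> \<Union>S"
  shows "partial I i (rep (section_of S F)) x = partial I i F x"
  using rep_section_of[OF assms(1)] by (intro partial_cong_open[OF open_Union_ImHP[OF assms(1)] assms(2)])

lemma partial2_rep_section_of:
  assumes "openin ImHP_topology S" "x \<in> \<Union>S"
  shows "partial I i (partial J j (rep (section_of S F))) x = partial I i (partial J j F) x"
  using partial_rep_section_of[OF assms(1)]
  by (intro partial_cong_open[OF open_Union_ImHP[OF assms(1)] assms(2)])

section \<open>The correspondence\<close>

definition to_potential :: "'n::finite conf set set \<Rightarrow> ('n \<Rightarrow> 'n \<Rightarrow> 'n field) \<Rightarrow> 'n field" where
  "to_potential S M = section_of S (quad (\<lambda>I J. rep (M I J)))"

definition to_matrix :: "'n::finite conf set set \<Rightarrow> 'n field \<Rightarrow> 'n \<Rightarrow> 'n \<Rightarrow> 'n field" where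
  "to_matrix S u I J = section_of S (\<lambda>x. 1/4 * contraction I J (rep u) x)"

context
  fixes S :: "'n::finite conf set set"
  assumes S: "openin ImHP_topology S"
begin

interpretation invariant_domain "\<Union>S" by (rule invariant_domain_Union[OF S])

lemma data_IbD:
  assumes "u \<in> data_Ib S"
  shows "u \<in> sections 1 S" "smooth_on (\<Union>S) (rep u)" "equivariant 1 (\<Union>S) (rep u)"
    "\<And>x I J j k. x \<in> \<Union>S \<Longrightarrow>
      partial I j (partial J k (rep u)) x = partial I k (partial J j (rep u)) x"
proof -
  have u: "u \<in> sections 1 S" and
    curl: "\<forall>I J. \<forall>x\<in>\<Union>S. \<forall>j k. partial I j (partial J k (rep u)) x = partial I k (partial J j (rep u)) x"
    using assms unfolding data_Ib_def ball_slices_iff[OF S] nabla_cross_eq_0_iff by blast+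
  show "u \<in> sections 1 S" by (rule u)
  show "smooth_on (\<Union>S) (rep u)" using u by (simp add: sections_def)
  show "equivariant 1 (\<Union>S) (rep u)" by (rule equivariant_rep[OF S u])
  show "partial I j (partial J k (rep u)) x = partial I k (partial J j (rep u)) x"
    if "x \<in> \<Union>S" for x I J j k
    using curl that by blast
qed

lemma potential_matrix_data_Ia:
  assumes "M \<in> data_Ia S"
  shows "potential_matrix (\<Union>S) (\<lambda>I J. rep (M I J))"
proof
  fix I J
  have s: "M I J \<in> sections (-1) S" for I J using assms by (simp add: data_Ia_def)
  then show "smooth_on (\<Union>S) (rep (M I J))" by (simp add: sections_def)
  show "equivariant (-1) (\<Union>S) (rep (M I J))" by (rule equivariant_rep[OF S s])
  show "rep (M I J) = rep (M J I)" using assms by (simp add: data_Ia_def)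
next
  fix x I i K J assume "x \<in> \<Union>S"
  then show "partial I i (rep (M K J)) x = partial J i (rep (M K I)) x"
    using assms unfolding data_Ia_def ball_slices_iff[OF S] nabla_eq_iff by blast
qed

lemma to_potential_in_data_Ib:
  assumes "M \<in> data_Ia S"
  shows "to_potential S M \<in> data_Ib S"
proof -
  interpret potential_matrix "\<Union>S" "\<lambda>I J. rep (M I J)" by (rule potential_matrix_data_Ia[OF assms])
  have "to_potential S M \<in> sections 1 S"
    unfolding to_potential_def
    by (intro section_of_in_sections[OF S] smooth_on_quad open_D smooth_U equivariant_quad equivariant_U)
  moreover have "partial I j (partial J k (rep (to_potential S M))) x =
      partial I k (partial J j (rep (to_potential S M))) x" if x: "x \<in> \<Union>S" for I J j k x
    unfolding to_potential_def partial2_rep_section_of[OF S x] by (rule curl_quad[OF x])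
  ultimately show ?thesis
    unfolding data_Ib_def ball_slices_iff[OF S] nabla_cross_eq_0_iff by blast
qed

lemma to_matrix_in_data_Ia:
  assumes "u \<in> data_Ib S"
  shows "to_matrix S u \<in> data_Ia S"
proof -
  note u = data_IbD[OF assms]
  have smooth: "smooth_on (\<Union>S) (contraction I J (rep u))" for I J
    by (rule smooth_on_contraction[OF open_D u(2)])
  \<comment> \<open>Contraction lowers the weight from 1 to 1 - 2 = -1.\<close>
  have "equivariant (-1) (\<Union>S) (contraction I J (rep u))" for I J
    using equivariant_contraction[OF u(2,3)] by simp
  then have "equivariant (-1) (\<Union>S) (\<lambda>x. 1/4 * contraction I J (rep u) x)" for I J
    by (simp add: equivariant_def)
  then have sec: "to_matrix S u I J \<in> sections (-1) S" for I J
    unfolding to_matrix_def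
    by (intro section_of_in_sections[OF S] smooth_on_mult open_D smooth_on_const smooth)
  have "to_matrix S u I J = to_matrix S u J I" for I J
  proof (rule section_eqI[OF S sec sec])
    fix x assume x: "x \<in> \<Union>S"
    show "rep (to_matrix S u I J) x = rep (to_matrix S u J I) x"
      unfolding to_matrix_def rep_section_of[OF S x] contraction_commute[OF u(2) x, of I J] ..
  qed
  moreover have "partial I i (rep (to_matrix S u K J)) x = partial J i (rep (to_matrix S u K I)) x"
    if x: "x \<in> \<Union>S" for I J K i x
    unfolding to_matrix_def partial_rep_section_of[OF S x]
      partial_cmult[OF smooth_on_differentiable[OF smooth x]]
    by (intro arg_cong[where f = "(*) (1/4)"] partial_contraction[OF u(2) x u(4)])
  ultimately show ?thesis
    unfolding data_Ia_def ball_slices_iff[OF S] nabla_eq_iff using sec by blast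
qed

lemma to_matrix_to_potential:
  assumes "M \<in> data_Ia S"
  shows "to_matrix S (to_potential S M) = M"
proof (rule ext, rule ext)
  fix I J
  interpret potential_matrix "\<Union>S" "\<lambda>I J. rep (M I J)" by (rule potential_matrix_data_Ia[OF assms])
  show "to_matrix S (to_potential S M) I J = M I J"
  proof (rule section_eqI[OF S, where w = "-1"])
    show "to_matrix S (to_potential S M) I J \<in> sections (- 1) S"
      using to_matrix_in_data_Ia[OF to_potential_in_data_Ib[OF assms]] by (simp add: data_Ia_def)
    show "M I J \<in> sections (- 1) S" using assms by (simp add: data_Ia_def)
    fix x assume x: "x \<in> \<Union>S"
    have "contraction I J (rep (to_potential S M)) x = 4 * rep (M I J) x"
      using contraction_quad[OF x, of I J]
      by (simp add: contraction_def to_potential_def partial2_rep_section_of[OF S x])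
    then show "rep (to_matrix S (to_potential S M) I J) x = rep (M I J) x"
      by (simp add: to_matrix_def rep_section_of[OF S x])
  qed
qed

lemma to_potential_to_matrix:
  assumes "u \<in> data_Ib S"
  shows "to_potential S (to_matrix S u) = u"
proof (rule section_eqI[OF S, where w = 1])
  note u = data_IbD[OF assms]
  show "to_potential S (to_matrix S u) \<in> sections 1 S"
    by (rule data_IbD(1)[OF to_potential_in_data_Ib[OF to_matrix_in_data_Ia[OF assms]]])
  show "u \<in> sections 1 S" by (rule u(1))
  fix x assume x: "x \<in> \<Union>S"
  have "rep (to_potential S (to_matrix S u)) x = quad (\<lambda>I J x. 1/4 * contraction I J (rep u) x) x"
    by (simp only: to_potential_def to_matrix_def rep_section_of[OF S x] quad_def)
  then show "rep (to_potential S (to_matrix S u)) x = rep u x"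
    by (simp only: quad_contraction[OF u(2,3) x u(4)])
qed

end

theorem lemma16:
  fixes S :: "'n::finite conf set set"
  assumes "openin ImHP_topology S"
  shows "\<exists>(\<Phi> :: ('n \<Rightarrow> 'n \<Rightarrow> 'n field) \<Rightarrow> 'n field) (\<Psi> :: 'n field \<Rightarrow> 'n \<Rightarrow> 'n \<Rightarrow> 'n field).
    bij_betw \<Phi> (data_Ia S) (data_Ib S) \<and>
    bij_betw \<Psi> (data_Ib S) (data_Ia S) \<and>
    (\<forall>M\<in>data_Ia S. \<Psi> (\<Phi> M) = M) \<and>
    (\<forall>u\<in>data_Ib S. \<Phi> (\<Psi> u) = u) \<and>
    (\<forall>M\<in>data_Ia S. \<forall>\<Sigma>. slice S \<Sigma> \<longrightarrow> (\<forall>\<rho>\<in>\<Sigma>.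
       rep (\<Phi> M) \<rho> = 2 * (\<Sum>I\<in>UNIV. \<Sum>J\<in>UNIV. rep (M I J) \<rho> * (\<rho> $ I \<bullet> \<rho> $ J)))) \<and>
    (\<forall>u\<in>data_Ib S. \<forall>I J. \<forall>\<Sigma>. slice S \<Sigma> \<longrightarrow> (\<forall>\<rho>\<in>\<Sigma>.
       rep (\<Psi> u I J) \<rho> = 1/4 * nabla_dot I J u \<rho>))"
proof (intro exI conjI)
  note inverse = to_matrix_to_potential[OF assms] to_potential_to_matrix[OF assms]
  note maps = to_potential_in_data_Ib[OF assms] to_matrix_in_data_Ia[OF assms]
  show "bij_betw (to_potential S) (data_Ia S) (data_Ib S)"
    by (rule bij_betw_byWitness[where f' = "to_matrix S"]) (auto simp: inverse maps)
  show "bij_betw (to_matrix S) (data_Ib S) (data_Ia S)"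
    by (rule bij_betw_byWitness[where f' = "to_potential S"]) (auto simp: inverse maps)
  show "\<forall>M\<in>data_Ia S. to_matrix S (to_potential S M) = M"
    "\<forall>u\<in>data_Ib S. to_potential S (to_matrix S u) = u"
    by (simp_all add: inverse)
  show "\<forall>M\<in>data_Ia S. \<forall>\<Sigma>. slice S \<Sigma> \<longrightarrow> (\<forall>\<rho>\<in>\<Sigma>.
      rep (to_potential S M) \<rho> = 2 * (\<Sum>I\<in>UNIV. \<Sum>J\<in>UNIV. rep (M I J) \<rho> * (\<rho> $ I \<bullet> \<rho> $ J)))"
    unfolding ball_slices_iff[OF assms]
    by (intro ballI) (simp only: to_potential_def rep_section_of[OF assms] quad_def)
  show "\<forall>u\<in>data_Ib S. \<forall>I J. \<forall>\<Sigma>. slice S \<Sigma> \<longrightarrow> (\<forall>\<rho>\<in>\<Sigma>.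
      rep (to_matrix S u I J) \<rho> = 1/4 * nabla_dot I J u \<rho>)"
    unfolding ball_slices_iff[OF assms]
    by (intro ballI allI) (simp only: to_matrix_def rep_section_of[OF assms] nabla_dot_eq_contraction)
qed

end
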